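(* Suppose that $a(z)\to c\in(0,\infty)$ as $z\to\infty$, and let $W_1,\dots,W_k$ be the Gaussian processes associated with this $c$. Then: (i) $(W_1(t),\,t\ge0)$ is a non-degenerate Gaussian process. (ii) For $\ell=1,\dots,k$, the process $(W_\ell(t),\,t\ge0)$ is non-self-similar, i.e. it is not self-similar with exponent $H$ for any $H$.
   Context: Fix integers $d\ge1$, $k\ge2$ and a connected graph $\Gamma$ with $k$ vertices. $a(z)=1/\psi'(z)$, $z>0$, where $\psi:[0,\infty)\to\mathbb{R}$ is of class $C^2$ with $\psi'(z)>0$, $\psi(z)\to\infty$, $(1/\psi')'(z)\to0$ as $z\to\infty$; it enters only through its limit $c$. $e_1=(1,0,\dots,0)\in\mathbb{R}^d$, $\langle\cdot,\cdot\rangle$ is the inner product, $s_{d-1}$ is the surface area of the unit sphere in $\mathbb{R}^d$. For a finite set $\mathcal{X}\subset\mathbb{R}^d$ and $t\ge0$, $G(\mathcal{X},t)$ is the undirected graph with vertex set $\mathcal{X}$ and an edge between distinct $x,y\in\mathcal{X}$ iff $\|x-y\|\le t$ (Euclidean norm); $\cong$ denotes graph isomorphism. For $x_1,\dots,x_k\in\mathbb{R}^d$, $h_t(x_1,\dots,x_k)=\mathbf{1}\{G(\{x_1,\dots,x_k\},t)\cong\Gamma\}$. Let $D_\ell=\dfrac{s_{d-1}}{\ell!\,((k-\ell)!)^2}$, $\ell=1,\dots,k$. For $\ell=2,\dots,k$ define the measure on $[0,\infty)\times(\mathbb{R}^d)^{\ell-1}$ $$\mu_\ell(d\rho\,d\mathbf{y})=D_\ell\,e^{-\ell\rho-c^{-1}\sum_{i=1}^{\ell-1}\langle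 e_1,y_i\rangle}\,\mathbf{1}\{\rho+c^{-1}\langle e_1,y_i\rangle\ge0,\ i=1,\dots,\ell-1\}\,d\rho\,d\mathbf{y},$$ and $\mu_1(d\rho)=D_1e^{-\rho}\,d\rho$ on $[0,\infty)$. Let $H_1,\dots,H_k$ be independent, $H_\ell$ a Gaussian $\mu_\ell$-noise (centered Gaussian random measure with $H_\ell(A)\sim\mathcal{N}(0,\mu_\ell(A))$ when $\mu_\ell(A)<\infty$, independent on disjoint sets). For $t\ge0$ define, for $2\le\ell\le k-1$, $$W_\ell(t)=\int_{[0,\infty)\times(\mathbb{R}^d)^{\ell-1}}\int_{(\mathbb{R}^d)^{k-\ell}}e^{-\sum_{i=1}^{k-\ell}(\rho+c^{-1}\langle e_1,z_i\rangle)}\,\mathbf{1}\{\rho+c^{-1}\langle e_1,z_i\rangle\ge0,\ i=1,\dots,k-\ell\}\,h_t(0,\mathbf{y},\mathbf{z})\,d\mathbf{z}\,H_\ell(d\rho\,d\mathbf{y}),$$ $$W_1(t)=\int_0^\infty\int_{(\mathbb{R}^d)^{k-1}}e^{-\sum_{i=1}^{k-1}(\rho+c^{-1}\langle e_1,z_i\rangle)}\,\mathbf{1}\{\rho+c^{-1}\langle e_1,z_i\rangle\ge0,\ i=1,\dots,k-1\}\,h_t(0,\mathbf{z})\,d\mathbf{z}\,H_1(d\rho),$$ $$W_k(t)=\int_{[0,\infty)\times(\mathbb{R}^d)^{k-1}}h_t(0,\mathbf{y})\,H_k(d\rho\,d\mathbf{y}).$$ A centered Gaussian process $(X(t),\,t\ge0)$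 is called degenerate if it is a deterministic function times a single Gaussian random variable, equivalently if its covariance function has the form $\mathbb{E}\{X(t)X(s)\}=g(t)g(s)$ for some deterministic function $g$; otherwise it is non-degenerate. A process $(X(t),\,t\ge0)$ is self-similar with exponent $H$ if $(X(ut_i),\,i=1,\dots,q)\stackrel{d}{=}(u^HX(t_i),\,i=1,\dots,q)$ for all $u>0$, $q\ge1$, $t_1,\dots,t_q\ge0$.
   Formalization: The graph Γ is additionally assumed to be realizable as G(X,t) for some finite X in R^d and some t ≥ 0; otherwise (e.g. d=1, Γ=K_{1,3}) h_t vanishes, all W_ℓ are zero, and both claims fail. *)

theory Defs
  imports "HOL-Probability.Probability"
begin

section \<open>Graphs\<close>

type_synonym 'v graph = "'v set \<times> 'v set set"

definition verts :: "'v graph \<Rightarrow> 'v set" where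
  "verts G = fst G"

definition edges :: "'v graph \<Rightarrow> 'v set set" where
  "edges G = snd G"

definition simple_graph :: "'v graph \<Rightarrow> bool" where
  "simple_graph G \<longleftrightarrow>
     finite (verts G) \<and>
     (\<forall>e\<in>edges G. \<exists>u\<in>verts G. \<exists>v\<in>verts G. u \<noteq> v \<and> e = {u, v})"

definition connected_graph :: "'v graph \<Rightarrow> bool" where
  "connected_graph G \<longleftrightarrow>
     verts G \<noteq> {} \<and>
     (\<forall>u\<in>verts G. \<forall>v\<in>verts G. (u, v) \<in> {(x, y). {x, y} \<in> edges G}\<^sup>*)"

definition graph_iso :: "'v graph \<Rightarrow> 'u graph \<Rightarrow> bool" where
  "graph_iso G G' \<longleftrightarrow>
     (\<exists>f. bij_betw f (verts G) (verts G') \<and>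
          (\<forall>u\<in>verts G. \<forall>v\<in>verts G. {u, v} \<in> edges G \<longleftrightarrow> {f u, f v} \<in> edges G'))"

definition geometric_graph :: "'a::real_normed_vector set \<Rightarrow> real \<Rightarrow> 'a graph" where
  "geometric_graph X t =
     (X, {{x, y} | x y. x \<in> X \<and> y \<in> X \<and> x \<noteq> y \<and> norm (x - y) \<le> t})"

text \<open>The tuple $(x_1,\dots,x_k)$ is passed as a list. If two entries coincide, the vertex
  set has fewer than $k$ elements and the value is 0 when \<open>\<Gamma>\<close> has $k$ vertices.\<close>

definition h_ind :: "'v graph \<Rightarrow> real \<Rightarrow> 'a::real_normed_vector list \<Rightarrow> real" where
  "h_ind \<Gamma> t xs = of_bool (graph_iso (geometric_graph (set xs) t) \<Gamma>)"


section \<open>Gaussian laws, processes and noises\<close>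

definition gaussian_law :: "real \<Rightarrow> real \<Rightarrow> real measure" where
  "gaussian_law m v =
     (if v = 0 then return borel m
      else density lborel (\<lambda>x. ennreal (normal_density m (sqrt v) x)))"

text \<open>Processes are indexed by $t \ge 0$; values at negative times are irrelevant.\<close>

definition centered_gaussian_process :: "'w measure \<Rightarrow> (real \<Rightarrow> 'w \<Rightarrow> real) \<Rightarrow> bool" where
  "centered_gaussian_process M X \<longleftrightarrow>
     (\<forall>t\<ge>0. X t \<in> borel_measurable M) \<and>
     (\<forall>F a. finite F \<and> F \<subseteq> {0..} \<longrightarrow>
        (\<exists>v\<ge>0. distr M borel (\<lambda>\<omega>. \<Sum>t\<in>F. a t * X t \<omega>) = gaussian_law 0 v))"

definition degenerate_process :: "'w measure \<Rightarrow> (real \<Rightarrow> 'w \<Rightarrow> real) \<Rightarrow> bool" where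
  "degenerate_process M X \<longleftrightarrow>
     (\<exists>g Z m v. Z \<in> borel_measurable M \<and> v \<ge> 0 \<and> distr M borel Z = gaussian_law m v \<and>
        (\<forall>t\<ge>0. AE \<omega> in M. X t \<omega> = g t * Z \<omega>))"

definition self_similar :: "'w measure \<Rightarrow> (real \<Rightarrow> 'w \<Rightarrow> real) \<Rightarrow> real \<Rightarrow> bool" where
  "self_similar M X \<eta> \<longleftrightarrow>
     (\<forall>u>0. \<forall>q\<ge>1. \<forall>t :: nat \<Rightarrow> real. (\<forall>i\<in>{1..q}. t i \<ge> 0) \<longrightarrow>
        distr M (PiM {1..q} (\<lambda>_. borel)) (\<lambda>\<omega>. \<lambda>i\<in>{1..q}. X (u * t i) \<omega>) =
        distr M (PiM {1..q} (\<lambda>_. borel)) (\<lambda>\<omega>. \<lambda>i\<in>{1..q}. u powr \<eta> * X (t i) \<omega>))"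

text \<open>Only the values of \<open>H\<close> on measurable sets of finite measure are constrained. Finite
  disjoint families are covered by padding with empty sets.\<close>

definition gaussian_noise ::
    "'w measure \<Rightarrow> 'a measure \<Rightarrow> ('a set \<Rightarrow> 'w \<Rightarrow> real) \<Rightarrow> bool" where
  "gaussian_noise M \<mu> H \<longleftrightarrow>
     (\<forall>A\<in>sets \<mu>. emeasure \<mu> A < \<infinity> \<longrightarrow>
        H A \<in> borel_measurable M \<and> distr M borel (H A) = gaussian_law 0 (measure \<mu> A)) \<and>
     (\<forall>A :: nat \<Rightarrow> 'a set.
        range A \<subseteq> sets \<mu> \<and> disjoint_family A \<and> (\<forall>n. emeasure \<mu> (A n) < \<infinity>) \<longrightarrow>
        prob_space.indep_vars M (\<lambda>_. borel) (\<lambda>n. H (A n)) UNIV) \<and>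
     (\<forall>A :: nat \<Rightarrow> 'a set.
        range A \<subseteq> sets \<mu> \<and> disjoint_family A \<and> emeasure \<mu> (\<Union>n. A n) < \<infinity> \<longrightarrow>
        (AE \<omega> in M. (\<lambda>n. H (A n) \<omega>) sums H (\<Union>n. A n) \<omega>))"

definition noise_events ::
    "'w measure \<Rightarrow> 'a measure \<Rightarrow> ('a set \<Rightarrow> 'w \<Rightarrow> real) \<Rightarrow> 'w set set" where
  "noise_events M \<mu> H =
     sigma_sets (space M)
       {H A -` B \<inter> space M | A B. A \<in> sets \<mu> \<and> emeasure \<mu> A < \<infinity> \<and> B \<in> sets borel}"

definition simple_noise_integral ::
    "'a measure \<Rightarrow> ('a set \<Rightarrow> 'w \<Rightarrow> real) \<Rightarrow> ('a \<Rightarrow> real) \<Rightarrow> 'w \<Rightarrow> real" where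
  "simple_noise_integral \<mu> H s \<omega> =
     (\<Sum>v\<in>s ` space \<mu> - {0}. v * H (s -` {v} \<inter> space \<mu>) \<omega>)"

text \<open>The stochastic integral $\int f\,dH$ is the $L^2(M)$-limit of integrals of simple functions
  converging to $f$ in $L^2(\mu)$. It is determined up to null sets, so it is rendered as the
  relation ``\<open>X\<close> is a version of $\int f\,dH$''. The convergences imply that $f$ and \<open>X\<close> are
  square integrable.\<close>

definition is_noise_integral ::
    "'w measure \<Rightarrow> 'a measure \<Rightarrow> ('a set \<Rightarrow> 'w \<Rightarrow> real) \<Rightarrow> ('a \<Rightarrow> real) \<Rightarrow> ('w \<Rightarrow> real) \<Rightarrow> bool"
  where
  "is_noise_integral M \<mu> H f X \<longleftrightarrow>
     f \<in> borel_measurable \<mu> \<and> X \<in> borel_measurable M \<and>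
     (\<exists>s :: nat \<Rightarrow> 'a \<Rightarrow> real.
        (\<forall>n. simple_function \<mu> (s n) \<and> emeasure \<mu> {x \<in> space \<mu>. s n x \<noteq> 0} < \<infinity>) \<and>
        (\<lambda>n. \<integral>\<^sup>+x. ennreal ((s n x - f x)\<^sup>2) \<partial>\<mu>) \<longlonglongrightarrow> 0 \<and>
        (\<lambda>n. \<integral>\<^sup>+\<omega>. ennreal ((simple_noise_integral \<mu> H (s n) \<omega> - X \<omega>)\<^sup>2) \<partial>M) \<longlonglongrightarrow> 0)"


section \<open>The control measures and the integrands\<close>

text \<open>There is no surface measure in the library; as usual it is obtained from Lebesgue measure
  via cones, so that the unit sphere has surface area $d$ times the volume of the unit ball, as
  spelled out in the lemma.\<close>

definition sphere_area :: "'d::finite itself \<Rightarrow> real" where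
  "sphere_area TYPE('d) = real CARD('d) * measure lborel (ball (0 :: real ^ 'd) 1)"

lemma sphere_area_eq:
  "sphere_area TYPE('d::finite) = 2 * pi powr (real CARD('d) / 2) / Gamma (real CARD('d) / 2)"
proof -
  have d: "real CARD('d) / 2 > 0" by simp
  have Gamma_eq: "Gamma (real CARD('d) / 2 + 1) = real CARD('d) / 2 * Gamma (real CARD('d) / 2)"
    by (rule Gamma_plus1) (use d in \<open>auto dest: nonpos_Ints_nonpos\<close>)
  show ?thesis
    by (simp add: sphere_area_def content_ball unit_ball_vol_def Gamma_eq)
qed

definition D_coeff :: "'d::finite itself \<Rightarrow> nat \<Rightarrow> nat \<Rightarrow> real" where
  "D_coeff TYPE('d) k l = sphere_area TYPE('d) / (fact l * (fact (k - l))\<^sup>2)"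

text \<open>$(\mathbb{R}^d)^m$ is the product of copies of Lebesgue measure over the index set
  $\{1,\dots,m\}$. For $m = 0$ it is a one-point space of mass 1, so that \<open>l = 1\<close> and
  \<open>l = k\<close> need no separate treatment below; the lemmas give these two cases explicitly.\<close>

definition mu :: "nat \<Rightarrow> real ^ 'd::finite \<Rightarrow> real \<Rightarrow> nat \<Rightarrow> (real \<times> (nat \<Rightarrow> real ^ 'd)) measure"
  where
  "mu k e c l =
     density (restrict_space lborel {0..} \<Otimes>\<^sub>M PiM {1..l - 1} (\<lambda>_. lborel))
       (\<lambda>(\<rho>, y). ennreal
          (D_coeff TYPE('d) k l * exp (- real l * \<rho> - (1 / c) * (\<Sum>i = 1..l - 1. e \<bullet> y i)) *
           of_bool (\<forall>i\<in>{1..l - 1}. \<rho> + (1 / c) * (e \<bullet> y i) \<ge> 0)))"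

definition W_integrand ::
    "'v graph \<Rightarrow> nat \<Rightarrow> real ^ 'd::finite \<Rightarrow> real \<Rightarrow> nat \<Rightarrow> real \<Rightarrow> real \<times> (nat \<Rightarrow> real ^ 'd) \<Rightarrow> real"
  where
  "W_integrand \<Gamma> k e c l t = (\<lambda>(\<rho>, y).
     \<integral>z. exp (- (\<Sum>i = 1..k - l. \<rho> + (1 / c) * (e \<bullet> z i))) *
         of_bool (\<forall>i\<in>{1..k - l}. \<rho> + (1 / c) * (e \<bullet> z i) \<ge> 0) *
         h_ind \<Gamma> t (0 # map y [1..<l] @ map z [1..<Suc (k - l)])
     \<partial>PiM {1..k - l} (\<lambda>_. lborel))"

lemma emeasure_mu_1:
  fixes e :: "real ^ 'd::finite"
  assumes "A \<in> sets (restrict_space lborel {0..})"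
  shows "emeasure (mu k e c 1) (A \<times> {\<lambda>_. undefined}) =
    emeasure (density (restrict_space lborel {0..}) (\<lambda>\<rho>. ennreal (D_coeff TYPE('d) k 1 * exp (- \<rho>)))) A"
proof -
  let ?R = "restrict_space lborel {0::real..}"
  let ?P = "PiM {} (\<lambda>_. lborel) :: (nat \<Rightarrow> real ^ 'd) measure"
  have P: "?P = count_space {\<lambda>_. undefined}"
    by (simp add: PiM_empty)
  interpret P: sigma_finite_measure ?P
    unfolding P by (rule sigma_finite_measure_count_space_finite) simp
  have [measurable]: "A \<in> sets ?R" by fact
  have [measurable]: "A \<times> {\<lambda>_. undefined} \<in> sets (?R \<Otimes>\<^sub>M ?P)"
    by (intro pair_measureI) (use assms in \<open>simp_all add: P\<close>)
  have [measurable]: "(\<lambda>x. f (fst x)) \<in> borel_measurable (?R \<Otimes>\<^sub>M ?P)"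
    if "f \<in> borel_measurable borel" for f :: "real \<Rightarrow> ennreal"
  proof -
    have "f \<in> borel_measurable ?R"
      using that by (intro measurable_restrict_space1) simp
    then show ?thesis by measurable
  qed
  have "emeasure (mu k e c 1) (A \<times> {\<lambda>_. undefined}) =
      (\<integral>\<^sup>+x. (case x of (\<rho>, y) \<Rightarrow> ennreal (D_coeff TYPE('d) k 1 * exp (- \<rho>))) *
         indicator (A \<times> {\<lambda>_. undefined}) x \<partial>(?R \<Otimes>\<^sub>M ?P))"
    by (simp add: mu_def emeasure_density case_prod_beta')
  also have "\<dots> = (\<integral>\<^sup>+\<rho>. \<integral>\<^sup>+y. ennreal (D_coeff TYPE('d) k 1 * exp (- \<rho>)) *
      indicator (A \<times> {\<lambda>_. undefined}) (\<rho>, y) \<partial>?P \<partial>?R)"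
    by (subst P.nn_integral_fst [symmetric]) (simp_all add: case_prod_beta')
  also have "\<dots> = (\<integral>\<^sup>+\<rho>. ennreal (D_coeff TYPE('d) k 1 * exp (- \<rho>)) * indicator A \<rho> \<partial>?R)"
    unfolding P by (intro nn_integral_cong)
      (simp add: nn_integral_count_space_finite indicator_times)
  finally show ?thesis
    using assms by (subst emeasure_density) (auto intro: measurable_restrict_space1)
qed

lemma W_integrand_k:
  "W_integrand \<Gamma> k e c k t (\<rho>, y) = h_ind \<Gamma> t (0 # map y [1..<k])"
  by (simp add: W_integrand_def PiM_empty lebesgue_integral_count_space_finite)

end

theory Submission
  imports Defs
begin

text \<open>
  Write $f_t$ for the deterministic integrand of $W_\ell(t)$ and
  $V(t) = \int f_t^2\,d\mu_\ell$. A limit of simple noise integrals is centred Gaussian with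
  variance the squared norm of its integrand, and the noise integral is linear
  (\<open>noise.noise_integral_law\<close>, \<open>noise.noise_integral_lin\<close>). So $W_1$ is a Gaussian process, and
  everything else is a statement about the functions $f_t$.

  Self-similarity. If $W_\ell$ were self-similar with exponent $\eta$, then
  $V(t) = V(1)\,t^{2\eta}$ with $V(1) > 0$. Connectedness of $\Gamma$ confines all points of a
  configuration counted by $h_t$ to a box of side $2r$ around the origin, where $r$ is proportional
  to $t$. Apart from a factor $e^{-\rho}$, the integral defining $V(t)$ gives each of its
  $N = 2k - \ell - 1$ free points ($\ell - 1$ shared points and two copies of the $k - \ell$
  integrated ones) the weight $e^{-(\rho + \langle e_1, x\rangle / c)}$ on the half-space where the
  exponent is non-positive. This weight is at most 1, and its integral along $e_1$ is at most $c$,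
  so each point contributes at most $\min(2r, c)\,(2r)^{d-1}$ (\<open>config.variance_le\<close>). Hence
  $V(t) \le C\,t^{dN}$ and $V(t) \le C'\,t^{(d-1)N}$ for all $t > 0$. A power of $t$ that is bounded
  by a multiple of another power on all of $(0, \infty)$ has the same exponent, so
  $dN = 2\eta = (d-1)N$, which is absurd as $N \ge 1$. In short, the weight confines each point to a
  slab of essentially fixed thickness, which is invisible at small scales and costs one dimension
  per point at large scales.

  Degeneracy. If $W_1(t) = g(t) Z$, then $g(1) f_s = g(s) f_1$ almost everywhere, for every $s$. The
  function $p_t(\rho) = e^{(k-1)\rho} f_t(\rho)$ is constant as soon as the half-space constraints
  hold automatically on the support of $h_t$, that is for $\rho \ge k^2 t / c$; but it is strictly
  smaller for $\rho$ near 0, because some realizations of $\Gamma$ violate the constraints. For small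
  $s$ there are therefore points where $p_s$ has already reached its final value and $p_1$ has not.
  Proportionality forces $g(s) = 0$, and then $f_s = 0$ almost everywhere, which is impossible since
  $\Gamma$ has realizations at every scale $s > 0$ (\<open>open_realization\<close>).
\<close>

section \<open>Gaussian laws and convergence in the mean square\<close>

lemma prob_space_gaussian_law: "v \<ge> 0 \<Longrightarrow> prob_space (gaussian_law 0 v)"
  by (auto simp: gaussian_law_def intro!: prob_space_return prob_space_normal_density)

lemma real_distribution_gaussian_law: "v \<ge> 0 \<Longrightarrow> real_distribution (gaussian_law 0 v)"
  using prob_space_gaussian_law[of v]
  by (auto simp: real_distribution_def real_distribution_axioms_def gaussian_law_def)

lemma char_gaussian_law:
  assumes "v \<ge> 0"
  shows "char (gaussian_law 0 v) \<theta> = complex_of_real (exp (- v * \<theta>\<^sup>2 / 2))"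
proof (cases "v = 0")
  case True
  then show ?thesis by (simp add: gaussian_law_def char_def integral_return)
next
  case False
  with assms have v: "v > 0" by simp
  interpret N: prob_space std_normal_distribution
    by (rule prob_space_normal_density) simp
  have "distributed std_normal_distribution lborel (\<lambda>x. x) std_normal_density"
    by (auto simp: distributed_def distr_id2)
  then have "distributed std_normal_distribution lborel (\<lambda>x. 0 + sqrt v * x)
      (normal_density (0 + sqrt v * 0) (\<bar>sqrt v\<bar> * 1))"
    by (rule N.normal_density_affine) (use v in auto)
  then have "distr std_normal_distribution lborel (\<lambda>x. sqrt v * x) = gaussian_law 0 v"
    using v by (simp add: distributed_def gaussian_law_def)
  moreover have "distr std_normal_distribution lborel (\<lambda>x. sqrt v * x) =
      distr std_normal_distribution borel (\<lambda>x. sqrt v * x)"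
    by (rule distr_cong) auto
  ultimately have "gaussian_law 0 v = distr std_normal_distribution borel (\<lambda>x. sqrt v * x)"
    by simp
  then have "char (gaussian_law 0 v) \<theta> = char std_normal_distribution (\<theta> * sqrt v)"
    by (simp add: char_def integral_distr mult.assoc)
  with v show ?thesis
    by (simp add: char_std_normal_distribution power_mult_distrib mult.commute)
qed

text \<open>Characteristic functions treat the degenerate law with $v = 0$ and the non-degenerate ones
  uniformly, which is why limits of Gaussian variables are identified through them.\<close>

lemma gaussian_law_eqI:
  assumes "prob_space M" "X \<in> borel_measurable M" "v \<ge> 0"
    and "\<And>\<theta>. char (distr M borel X) \<theta> = complex_of_real (exp (- v * \<theta>\<^sup>2 / 2))"
  shows "distr M borel X = gaussian_law 0 v"
  using assms prob_space.real_distribution_distr[OF assms(1)]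
  by (intro Levy_uniqueness real_distribution_gaussian_law ext) (auto simp: char_gaussian_law)

lemma gaussian_law_inject:
  assumes "v \<ge> 0" "w \<ge> 0" "gaussian_law 0 v = gaussian_law 0 w"
  shows "v = w"
proof -
  have "complex_of_real (exp (- v * 1\<^sup>2 / 2)) = complex_of_real (exp (- w * 1\<^sup>2 / 2))"
    using char_gaussian_law[OF assms(1), of 1] char_gaussian_law[OF assms(2), of 1] assms(3)
    by metis
  then have "exp (- v * 1\<^sup>2 / 2) = exp (- w * 1\<^sup>2 / 2)"
    by (simp only: of_real_eq_iff)
  then show ?thesis by simp
qed

lemma tendsto_zero_of_square_le:
  assumes le: "\<And>n. ennreal ((d n)\<^sup>2) \<le> e n" and e: "e \<longlonglongrightarrow> 0"
  shows "d \<longlonglongrightarrow> (0 :: real)"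
proof -
  have "(\<lambda>n. ennreal ((d n)\<^sup>2)) \<longlonglongrightarrow> ennreal 0"
    unfolding ennreal_0 by (rule tendsto_sandwich[OF _ _ tendsto_const e]) (simp_all add: le)
  then have "(\<lambda>n. (d n)\<^sup>2) \<longlonglongrightarrow> 0"
    by (subst (asm) tendsto_ennreal_iff) auto
  then have "(\<lambda>n. sqrt ((d n)\<^sup>2)) \<longlonglongrightarrow> sqrt 0"
    by (rule tendsto_real_sqrt)
  then show ?thesis
    by (simp add: tendsto_rabs_zero_iff)
qed

text \<open>Since $x \mapsto e^{i\theta x}$ is Lipschitz with constant $|\theta|$, the difference of the
  characteristic functions is at most $|\theta|$ times the $L^1$-distance, which the Cauchy--Schwarz
  inequality bounds by the $L^2$-distance.\<close>

lemma char_tendsto_of_L2: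
  assumes "prob_space M" and [measurable]: "\<And>n. Y n \<in> borel_measurable M" "X \<in> borel_measurable M"
    and lim: "(\<lambda>n. \<integral>\<^sup>+\<omega>. ennreal ((Y n \<omega> - X \<omega>)\<^sup>2) \<partial>M) \<longlonglongrightarrow> 0"
  shows "(\<lambda>n. char (distr M borel (Y n)) \<theta>) \<longlonglongrightarrow> char (distr M borel X) \<theta>"
proof -
  interpret prob_space M by fact
  define d where "d n = norm (char (distr M borel (Y n)) \<theta> - char (distr M borel X) \<theta>)" for n
  have bound: "ennreal ((d n)\<^sup>2) \<le> ennreal (\<theta>\<^sup>2) * (\<integral>\<^sup>+\<omega>. ennreal ((Y n \<omega> - X \<omega>)\<^sup>2) \<partial>M)" for n
  proof -
    have int: "integrable M (\<lambda>\<omega>. iexp (\<theta> * Z \<omega>))" if [measurable]: "Z \<in> borel_measurable M" for Z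
      by (rule integrable_iexp) auto
    have ptw: "norm (iexp (\<theta> * Y n \<omega>) - iexp (\<theta> * X \<omega>)) \<le> \<bar>\<theta>\<bar> * \<bar>Y n \<omega> - X \<omega>\<bar>" for \<omega>
    proof -
      have "iexp (\<theta> * Y n \<omega>) - iexp (\<theta> * X \<omega>)
          = iexp (\<theta> * X \<omega>) * (iexp (\<theta> * (Y n \<omega> - X \<omega>)) - 1)"
        by (simp add: algebra_simps flip: exp_add)
      then have "norm (iexp (\<theta> * Y n \<omega>) - iexp (\<theta> * X \<omega>))
          = norm (iexp (\<theta> * (Y n \<omega> - X \<omega>)) - 1)"
        by (metis mult_1 norm_exp_i_times norm_mult)
      also have "\<dots> \<le> \<bar>\<theta> * (Y n \<omega> - X \<omega>)\<bar>"
        using iexp_approx1[of "\<theta> * (Y n \<omega> - X \<omega>)" 0] by simp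
      finally show ?thesis by (simp add: abs_mult)
    qed
    have "ennreal (d n) = ennreal (norm (\<integral>\<omega>. iexp (\<theta> * Y n \<omega>) - iexp (\<theta> * X \<omega>) \<partial>M))"
      unfolding d_def char_def using int
      by (simp add: integral_distr flip: Bochner_Integration.integral_diff)
    also have "\<dots> \<le> (\<integral>\<^sup>+\<omega>. ennreal (norm (iexp (\<theta> * Y n \<omega>) - iexp (\<theta> * X \<omega>))) \<partial>M)"
      by (intro integral_norm_bound_ennreal Bochner_Integration.integrable_diff int) auto
    also have "\<dots> \<le> (\<integral>\<^sup>+\<omega>. ennreal \<bar>\<theta>\<bar> * ennreal \<bar>Y n \<omega> - X \<omega>\<bar> \<partial>M)"
      by (intro nn_integral_mono) (use ptw in \<open>auto simp flip: ennreal_mult\<close>)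
    finally have "(ennreal (d n))\<^sup>2 \<le> (\<integral>\<^sup>+\<omega>. ennreal \<bar>\<theta>\<bar> * ennreal \<bar>Y n \<omega> - X \<omega>\<bar> \<partial>M)\<^sup>2"
      by (intro power_mono) auto
    also have "\<dots> \<le> (\<integral>\<^sup>+\<omega>. (ennreal \<bar>\<theta>\<bar>)\<^sup>2 \<partial>M) * (\<integral>\<^sup>+\<omega>. (ennreal \<bar>Y n \<omega> - X \<omega>\<bar>)\<^sup>2 \<partial>M)"
      by (rule Cauchy_Schwarz_nn_integral) auto
    finally show ?thesis
      by (simp add: d_def ennreal_power emeasure_space_1)
  qed
  have "(\<lambda>n. ennreal (\<theta>\<^sup>2) * (\<integral>\<^sup>+\<omega>. ennreal ((Y n \<omega> - X \<omega>)\<^sup>2) \<partial>M)) \<longlonglongrightarrow> ennreal (\<theta>\<^sup>2) * 0"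
    by (intro ennreal_tendsto_cmult lim) auto
  then have "d \<longlonglongrightarrow> 0"
    by (intro tendsto_zero_of_square_le[OF bound]) simp
  then show ?thesis
    unfolding d_def by (simp add: LIM_zero_iff tendsto_norm_zero_iff)
qed

text \<open>The factorization $s_n^2 - f^2 = (s_n - f)(s_n + f)$ and the Cauchy--Schwarz inequality reduce
  the second claim to boundedness of $\|s_n + f\|$.\<close>

lemma square_integral_tendsto_of_L2:
  fixes f :: "'a \<Rightarrow> real"
  assumes [measurable]: "\<And>n. s n \<in> borel_measurable M" "f \<in> borel_measurable M"
    and s: "\<And>n. integrable M (\<lambda>x. (s n x)\<^sup>2)"
    and lim: "(\<lambda>n. \<integral>\<^sup>+x. ennreal ((s n x - f x)\<^sup>2) \<partial>M) \<longlonglongrightarrow> 0"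
  shows "integrable M (\<lambda>x. (f x)\<^sup>2)" "(\<lambda>n. \<integral>x. (s n x)\<^sup>2 \<partial>M) \<longlonglongrightarrow> (\<integral>x. (f x)\<^sup>2 \<partial>M)"
proof -
  define d where "d n = (\<integral>\<^sup>+x. ennreal ((s n x - f x)\<^sup>2) \<partial>M)" for n
  have "\<forall>\<^sub>F n in sequentially. d n < 1"
    using lim unfolding d_def by (rule order_tendstoD) simp
  then obtain n where n: "d n < 1" by (auto simp: eventually_sequentially)
  have "integrable M (\<lambda>x. (s n x - f x)\<^sup>2)"
    by (rule integrableI_bounded) (use n in \<open>auto simp: d_def intro: less_trans\<close>)
  then have "integrable M (\<lambda>x. 2 * (s n x)\<^sup>2 + 2 * (s n x - f x)\<^sup>2)"
    using s by auto
  then show f: "integrable M (\<lambda>x. (f x)\<^sup>2)"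
  proof (rule Bochner_Integration.integrable_bound, measurable, intro AE_I2)
    fix x
    \<comment> \<open>This square is $2s^2 + 2(s - f)^2 - f^2$.\<close>
    have "0 \<le> (f x - 2 * s n x)\<^sup>2" by simp
    then show "norm ((f x)\<^sup>2) \<le> norm (2 * (s n x)\<^sup>2 + 2 * (s n x - f x)\<^sup>2)"
      by (simp add: power2_eq_square algebra_simps)
  qed
  define b where "b = (\<integral>x. (f x)\<^sup>2 \<partial>M)"
  have b: "(\<integral>\<^sup>+x. ennreal ((f x)\<^sup>2) \<partial>M) = ennreal b"
    unfolding b_def by (rule nn_integral_eq_integral[OF f]) auto
  define r where "r n = \<bar>(\<integral>x. (s n x)\<^sup>2 \<partial>M) - b\<bar>" for n
  have bound: "ennreal ((r n)\<^sup>2) \<le> d n * (2 * d n + ennreal (8 * b))" for n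
  proof -
    have "ennreal (r n) = ennreal (norm (\<integral>x. (s n x)\<^sup>2 - (f x)\<^sup>2 \<partial>M))"
      using s f by (simp add: r_def b_def)
    also have "\<dots> \<le> (\<integral>\<^sup>+x. ennreal (norm ((s n x)\<^sup>2 - (f x)\<^sup>2)) \<partial>M)"
      by (intro integral_norm_bound_ennreal) (use s f in auto)
    also have "\<dots> = (\<integral>\<^sup>+x. ennreal \<bar>s n x - f x\<bar> * ennreal \<bar>s n x + f x\<bar> \<partial>M)"
      by (intro nn_integral_cong)
        (simp add: power2_eq_square square_diff_square_factored abs_mult mult.commute flip: ennreal_mult)
    finally have "(ennreal (r n))\<^sup>2 \<le> (\<integral>\<^sup>+x. ennreal \<bar>s n x - f x\<bar> * ennreal \<bar>s n x + f x\<bar> \<partial>M)\<^sup>2"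
      by (intro power_mono) auto
    also have "\<dots> \<le> (\<integral>\<^sup>+x. (ennreal \<bar>s n x - f x\<bar>)\<^sup>2 \<partial>M) * (\<integral>\<^sup>+x. (ennreal \<bar>s n x + f x\<bar>)\<^sup>2 \<partial>M)"
      by (rule Cauchy_Schwarz_nn_integral) auto
    also have "\<dots> = d n * (\<integral>\<^sup>+x. ennreal ((s n x + f x)\<^sup>2) \<partial>M)"
      by (simp add: d_def ennreal_power)
    \<comment> \<open>$s + f = (s - f) + 2f$ and $(a + b)^2 \le 2a^2 + 2b^2$.\<close>
    also have "(\<integral>\<^sup>+x. ennreal ((s n x + f x)\<^sup>2) \<partial>M)
        \<le> (\<integral>\<^sup>+x. 2 * ennreal ((s n x - f x)\<^sup>2) + 8 * ennreal ((f x)\<^sup>2) \<partial>M)"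
    proof (intro nn_integral_mono)
      fix x
      have "0 \<le> (s n x - 3 * f x)\<^sup>2" by simp
      then have "(s n x + f x)\<^sup>2 \<le> 2 * (s n x - f x)\<^sup>2 + 8 * (f x)\<^sup>2"
        by (simp add: power2_eq_square algebra_simps)
      then show "ennreal ((s n x + f x)\<^sup>2) \<le> 2 * ennreal ((s n x - f x)\<^sup>2) + 8 * ennreal ((f x)\<^sup>2)"
        by (simp add: ennreal_leI flip: ennreal_numeral ennreal_mult ennreal_plus)
    qed
    also have "\<dots> = 2 * d n + ennreal (8 * b)"
      by (simp add: nn_integral_add nn_integral_cmult b d_def b_def ennreal_mult)
    finally show ?thesis
      by (simp add: r_def ennreal_power mult_left_mono)
  qed
  have "(\<lambda>n. d n * (2 * d n + ennreal (8 * b))) \<longlonglongrightarrow> 0 * (2 * 0 + ennreal (8 * b))"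
    using lim unfolding d_def[symmetric]
    by (intro tendsto_mult_ennreal tendsto_add ennreal_tendsto_cmult tendsto_const) auto
  then have "r \<longlonglongrightarrow> 0"
    by (intro tendsto_zero_of_square_le[OF bound]) simp
  then show "(\<lambda>n. \<integral>x. (s n x)\<^sup>2 \<partial>M) \<longlonglongrightarrow> (\<integral>x. (f x)\<^sup>2 \<partial>M)"
    unfolding r_def b_def by (simp add: LIM_zero_iff tendsto_rabs_zero_iff)
qed

lemma L2_lin_tendsto:
  fixes f g :: "'b \<Rightarrow> real"
  assumes [measurable]: "\<And>n. u n \<in> borel_measurable N" "\<And>n. v n \<in> borel_measurable N"
      "f \<in> borel_measurable N" "g \<in> borel_measurable N"
    and u: "(\<lambda>n. \<integral>\<^sup>+x. ennreal ((u n x - f x)\<^sup>2) \<partial>N) \<longlonglongrightarrow> 0"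
    and v: "(\<lambda>n. \<integral>\<^sup>+x. ennreal ((v n x - g x)\<^sup>2) \<partial>N) \<longlonglongrightarrow> 0"
    and w: "\<And>n. AE x in N. w n x = a * u n x + b * v n x"
  shows "(\<lambda>n. \<integral>\<^sup>+x. ennreal ((w n x - (a * f x + b * g x))\<^sup>2) \<partial>N) \<longlonglongrightarrow> 0"
proof (rule tendsto_sandwich[OF _ _ tendsto_const])
  show "\<forall>\<^sub>F n in sequentially. (\<integral>\<^sup>+x. ennreal ((w n x - (a * f x + b * g x))\<^sup>2) \<partial>N) \<le>
      ennreal (2 * a\<^sup>2) * (\<integral>\<^sup>+x. ennreal ((u n x - f x)\<^sup>2) \<partial>N) +
      ennreal (2 * b\<^sup>2) * (\<integral>\<^sup>+x. ennreal ((v n x - g x)\<^sup>2) \<partial>N)"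
  proof (intro always_eventually allI)
    fix n
    have "(\<integral>\<^sup>+x. ennreal ((w n x - (a * f x + b * g x))\<^sup>2) \<partial>N) \<le>
      (\<integral>\<^sup>+x. ennreal (2 * a\<^sup>2) * ennreal ((u n x - f x)\<^sup>2) + ennreal (2 * b\<^sup>2) * ennreal ((v n x - g x)\<^sup>2) \<partial>N)"
    proof (rule nn_integral_mono_AE, use w[of n] in eventually_elim)
      case (elim x)
      let ?p = "a * (u n x - f x)" and ?q = "b * (v n x - g x)"
      have "0 \<le> (?p - ?q)\<^sup>2" by simp
      then have "(?p + ?q)\<^sup>2 \<le> 2 * ?p\<^sup>2 + 2 * ?q\<^sup>2"
        unfolding power2_sum power2_diff by linarith
      moreover have "w n x - (a * f x + b * g x) = ?p + ?q"
        using elim by (simp add: algebra_simps)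
      ultimately have "(w n x - (a * f x + b * g x))\<^sup>2
          \<le> (2 * a\<^sup>2) * (u n x - f x)\<^sup>2 + (2 * b\<^sup>2) * (v n x - g x)\<^sup>2"
        by (simp add: power_mult_distrib)
      then show ?case
        by (simp add: ennreal_leI flip: ennreal_mult ennreal_plus)
    qed
    also have "\<dots> = ennreal (2 * a\<^sup>2) * (\<integral>\<^sup>+x. ennreal ((u n x - f x)\<^sup>2) \<partial>N) +
      ennreal (2 * b\<^sup>2) * (\<integral>\<^sup>+x. ennreal ((v n x - g x)\<^sup>2) \<partial>N)"
      by (simp add: nn_integral_add nn_integral_cmult)
    finally show "(\<integral>\<^sup>+x. ennreal ((w n x - (a * f x + b * g x))\<^sup>2) \<partial>N) \<le>
      ennreal (2 * a\<^sup>2) * (\<integral>\<^sup>+x. ennreal ((u n x - f x)\<^sup>2) \<partial>N) +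
      ennreal (2 * b\<^sup>2) * (\<integral>\<^sup>+x. ennreal ((v n x - g x)\<^sup>2) \<partial>N)" .
  qed
  have "(\<lambda>n. ennreal (2 * a\<^sup>2) * (\<integral>\<^sup>+x. ennreal ((u n x - f x)\<^sup>2) \<partial>N) +
      ennreal (2 * b\<^sup>2) * (\<integral>\<^sup>+x. ennreal ((v n x - g x)\<^sup>2) \<partial>N)) \<longlonglongrightarrow> ennreal (2 * a\<^sup>2) * 0 + ennreal (2 * b\<^sup>2) * 0"
    by (intro tendsto_add ennreal_tendsto_cmult u v) auto
  then show "(\<lambda>n. ennreal (2 * a\<^sup>2) * (\<integral>\<^sup>+x. ennreal ((u n x - f x)\<^sup>2) \<partial>N) +
      ennreal (2 * b\<^sup>2) * (\<integral>\<^sup>+x. ennreal ((v n x - g x)\<^sup>2) \<partial>N)) \<longlonglongrightarrow> 0"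
    by simp
qed auto

section \<open>Integrals with respect to a Gaussian noise\<close>

locale noise = prob_space M for M :: "'w measure" +
  fixes \<mu> :: "'a measure" and H :: "'a set \<Rightarrow> 'w \<Rightarrow> real"
  assumes gaussian: "gaussian_noise M \<mu> H"
begin

lemma noise_measurable:
  "A \<in> sets \<mu> \<Longrightarrow> emeasure \<mu> A < \<infinity> \<Longrightarrow> H A \<in> borel_measurable M"
  and noise_law:
  "A \<in> sets \<mu> \<Longrightarrow> emeasure \<mu> A < \<infinity> \<Longrightarrow> distr M borel (H A) = gaussian_law 0 (measure \<mu> A)"
  using gaussian by (auto simp: gaussian_noise_def)

lemma noise_empty: "AE \<omega> in M. H {} \<omega> = 0"
proof -
  have [measurable]: "H {} \<in> borel_measurable M"
    by (rule noise_measurable) auto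
  have "distr M borel (H {}) = return borel 0"
    using noise_law[of "{}"] by (simp add: gaussian_law_def)
  then have "AE x in distr M borel (H {}). x = 0"
    by (subst \<open>distr M borel (H {}) = return borel 0\<close>, subst AE_return) auto
  then show ?thesis by (subst (asm) AE_distr_iff) auto
qed

text \<open>Only countable additivity is postulated for a noise; finite additivity follows by padding with
  empty sets, on which the noise vanishes almost surely.\<close>

lemma noise_Un:
  assumes "A \<in> sets \<mu>" "B \<in> sets \<mu>" "A \<inter> B = {}" "emeasure \<mu> (A \<union> B) < \<infinity>"
  shows "AE \<omega> in M. H (A \<union> B) \<omega> = H A \<omega> + H B \<omega>"
proof -
  define F where "F n = (if n = 0 then A else if n = 1 then B else {})" for n :: nat
  have U: "(\<Union>n. F n) = A \<union> B"
    by (auto simp: F_def split: if_splits)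
  have "disjoint_family F"
    using assms(3) by (auto simp: disjoint_family_on_def F_def)
  moreover have "range F \<subseteq> sets \<mu>"
    using assms(1,2) by (auto simp: F_def)
  ultimately have "AE \<omega> in M. (\<lambda>n. H (F n) \<omega>) sums H (A \<union> B) \<omega>"
    using gaussian assms(4) unfolding gaussian_noise_def U[symmetric] by blast
  then show ?thesis
    using noise_empty
  proof eventually_elim
    case (elim \<omega>)
    have "(\<lambda>n. H (F n) \<omega>) sums (\<Sum>n\<in>{0, 1}. H (F n) \<omega>)"
      by (rule sums_finite) (use elim(2) in \<open>auto simp: F_def\<close>)
    with elim(1) show ?case
      using sums_unique2 by (fastforce simp: F_def)
  qed
qed

lemma noise_finite_Union:
  assumes "finite I" "\<And>i. i \<in> I \<Longrightarrow> A i \<in> sets \<mu>" "\<And>i. i \<in> I \<Longrightarrow> emeasure \<mu> (A i) < \<infinity>"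
    and "disjoint_family_on A I"
  shows "AE \<omega> in M. H (\<Union>i\<in>I. A i) \<omega> = (\<Sum>i\<in>I. H (A i) \<omega>)"
  using assms
proof (induction I)
  case empty
  then show ?case using noise_empty by simp
next
  case (insert i I)
  have disj: "A i \<inter> (\<Union>j\<in>I. A j) = {}" "disjoint_family_on A I"
    using insert.prems(3) insert.hyps by (auto simp: disjoint_family_on_def)
  have "emeasure \<mu> (\<Union>j\<in>insert i I. A j) \<le> (\<Sum>j\<in>insert i I. emeasure \<mu> (A j))"
    by (rule emeasure_subadditive_finite) (use insert in auto)
  also have "\<dots> < \<infinity>"
    using insert by (simp add: ennreal_sum_less_top)
  finally have "AE \<omega> in M. H (A i \<union> (\<Union>j\<in>I. A j)) \<omega> = H (A i) \<omega> + H (\<Union>j\<in>I. A j) \<omega>"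
    by (intro noise_Un) (use insert.prems insert.hyps disj in auto)
  moreover have "AE \<omega> in M. H (\<Union>j\<in>I. A j) \<omega> = (\<Sum>j\<in>I. H (A j) \<omega>)"
    by (rule insert.IH) (use insert.prems disj in auto)
  ultimately show ?case
    by eventually_elim (use insert.hyps in simp)
qed

definition finite_support :: "('a \<Rightarrow> real) \<Rightarrow> bool" where
  "finite_support s \<longleftrightarrow> simple_function \<mu> s \<and> emeasure \<mu> {x \<in> space \<mu>. s x \<noteq> 0} < \<infinity>"

lemma finite_support_level:
  assumes "finite_support s" "v \<noteq> 0"
  shows "s -` {v} \<inter> space \<mu> \<in> sets \<mu>" "emeasure \<mu> (s -` {v} \<inter> space \<mu>) < \<infinity>"
proof -
  show "s -` {v} \<inter> space \<mu> \<in> sets \<mu>"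
    using assms by (auto simp: finite_support_def dest: simple_functionD)
  have [measurable]: "s \<in> borel_measurable \<mu>"
    using assms by (auto simp: finite_support_def intro: borel_measurable_simple_function)
  have "emeasure \<mu> (s -` {v} \<inter> space \<mu>) \<le> emeasure \<mu> {x \<in> space \<mu>. s x \<noteq> 0}"
    by (rule emeasure_mono) (use assms in auto)
  then show "emeasure \<mu> (s -` {v} \<inter> space \<mu>) < \<infinity>"
    using assms by (auto simp: finite_support_def intro: le_less_trans)
qed

lemma finite_support_finite: "finite_support s \<Longrightarrow> finite (s ` space \<mu>)"
  by (auto simp: finite_support_def simple_function_def)

lemma simple_noise_integral_measurable:
  assumes "finite_support s"
  shows "simple_noise_integral \<mu> H s \<in> borel_measurable M"
  unfolding simple_noise_integral_def[abs_def]
  by (intro borel_measurable_sum borel_measurable_times borel_measurable_const noise_measurable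
        finite_support_level[OF assms]) auto

text \<open>The simple integral is defined through the level sets of the integrand. Linearity needs its value
  for partitions finer than the one into level sets, since two functions have to be
  represented on a common partition.\<close>

lemma simple_noise_integral_partition:
  assumes "finite I" "\<And>i. i \<in> I \<Longrightarrow> A i \<in> sets \<mu>" "\<And>i. i \<in> I \<Longrightarrow> emeasure \<mu> (A i) < \<infinity>"
    and disj: "disjoint_family_on A I"
    and s: "\<And>i x. i \<in> I \<Longrightarrow> x \<in> A i \<Longrightarrow> s x = a i"
      "\<And>x. x \<in> space \<mu> - (\<Union>i\<in>I. A i) \<Longrightarrow> s x = 0"
  shows "AE \<omega> in M. simple_noise_integral \<mu> H s \<omega> = (\<Sum>i\<in>I. a i * H (A i) \<omega>)"
proof -
  define V where "V = s ` space \<mu> - {0}"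
  have sub: "A i \<subseteq> space \<mu>" if "i \<in> I" for i
    using assms(2)[OF that] by (rule sets.sets_into_space)
  have "s ` space \<mu> \<subseteq> insert 0 (a ` I)"
    using s by blast
  then have "finite V"
    unfolding V_def using \<open>finite I\<close> by (metis finite_Diff finite_imageI finite_insert finite_subset)
  have level: "s -` {v} \<inter> space \<mu> = (\<Union>i\<in>{i\<in>I. a i = v}. A i)" if "v \<in> V" for v
  proof (intro set_eqI iffI)
    fix x assume "x \<in> s -` {v} \<inter> space \<mu>"
    then show "x \<in> (\<Union>i\<in>{i\<in>I. a i = v}. A i)"
      using s that by (cases "x \<in> (\<Union>i\<in>I. A i)") (auto simp: V_def)
  next
    fix x assume "x \<in> (\<Union>i\<in>{i\<in>I. a i = v}. A i)"
    then obtain i where "i \<in> I" "a i = v" "x \<in> A i" by blast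
    then show "x \<in> s -` {v} \<inter> space \<mu>"
      using s(1) sub[of i] by auto
  qed
  have "AE \<omega> in M. \<forall>v\<in>V. H (s -` {v} \<inter> space \<mu>) \<omega> = (\<Sum>i\<in>{i\<in>I. a i = v}. H (A i) \<omega>)"
    unfolding AE_finite_all[OF \<open>finite V\<close>]
  proof
    fix v assume "v \<in> V"
    show "AE \<omega> in M. H (s -` {v} \<inter> space \<mu>) \<omega> = (\<Sum>i\<in>{i\<in>I. a i = v}. H (A i) \<omega>)"
      unfolding level[OF \<open>v \<in> V\<close>]
      by (rule noise_finite_Union) (use assms in \<open>auto simp: disjoint_family_on_def\<close>)
  qed
  then show ?thesis
    using noise_empty
  proof eventually_elim
    case (elim \<omega>)
    have "simple_noise_integral \<mu> H s \<omega> = (\<Sum>v\<in>V. \<Sum>i\<in>{i\<in>I. a i = v}. a i * H (A i) \<omega>)"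
      unfolding simple_noise_integral_def V_def[symmetric]
      using elim by (intro sum.cong refl) (simp add: sum_distrib_left)
    also have "\<dots> = (\<Sum>v\<in>V. \<Sum>i\<in>{i\<in>{i\<in>I. a i \<in> V}. a i = v}. a i * H (A i) \<omega>)"
      by (intro sum.cong) auto
    also have "\<dots> = (\<Sum>i\<in>{i\<in>I. a i \<in> V}. a i * H (A i) \<omega>)"
      by (rule sum.group) (use \<open>finite I\<close> \<open>finite V\<close> in auto)
    also have "\<dots> = (\<Sum>i\<in>I. a i * H (A i) \<omega>)"
    proof (rule sum.mono_neutral_left)
      show "\<forall>i\<in>I - {i\<in>I. a i \<in> V}. a i * H (A i) \<omega> = 0"
      proof safe
        fix i assume i: "i \<in> I" "a i * H (A i) \<omega> \<noteq> 0"
        then have "a i \<noteq> 0" "A i \<noteq> {}" using elim(2) by auto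
        then obtain x where "x \<in> A i" "s x = a i" "x \<in> space \<mu>"
          using s(1)[OF i(1)] sub[OF i(1)] by blast
        with \<open>a i \<noteq> 0\<close> show "a i \<in> V"
          by (auto simp: V_def intro: image_eqI[of _ _ x])
      qed
    qed (use \<open>finite I\<close> in auto)
    finally show ?case .
  qed
qed

lemma finite_support_lin:
  assumes "finite_support s" "finite_support s'"
  shows "finite_support (\<lambda>x. a * s x + b * s' x)"
proof -
  have [measurable]: "s \<in> borel_measurable \<mu>" "s' \<in> borel_measurable \<mu>"
    using assms by (auto simp: finite_support_def intro: borel_measurable_simple_function)
  have "simple_function \<mu> (\<lambda>x. a * s x + b * s' x)"
    using assms unfolding finite_support_def
    by (intro simple_function_add simple_function_mult simple_function_const) auto
  moreover have "emeasure \<mu> {x \<in> space \<mu>. a * s x + b * s' x \<noteq> 0}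
      \<le> emeasure \<mu> ({x \<in> space \<mu>. s x \<noteq> 0} \<union> {x \<in> space \<mu>. s' x \<noteq> 0})"
    by (rule emeasure_mono) auto
  moreover have "\<dots> \<le> emeasure \<mu> {x \<in> space \<mu>. s x \<noteq> 0} + emeasure \<mu> {x \<in> space \<mu>. s' x \<noteq> 0}"
    by (rule emeasure_subadditive) auto
  ultimately show ?thesis
    using assms unfolding finite_support_def
    by (metis (no_types, lifting) ennreal_add_eq_top infinity_ennreal_def order_le_less_trans top.not_eq_extremum)
qed

text \<open>Both functions are constant on the joint level sets; the pair $(0, 0)$ is left out because its
  level set may have infinite measure.\<close>

lemma simple_noise_integral_lin:
  assumes s: "finite_support s" and s': "finite_support s'"
  shows "AE \<omega> in M. simple_noise_integral \<mu> H (\<lambda>x. a * s x + b * s' x) \<omega> =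
    a * simple_noise_integral \<mu> H s \<omega> + b * simple_noise_integral \<mu> H s' \<omega>"
proof -
  define I where "I = s ` space \<mu> \<times> s' ` space \<mu> - {(0, 0)}"
  define A where "A p = (s -` {fst p} \<inter> space \<mu>) \<inter> (s' -` {snd p} \<inter> space \<mu>)" for p
  have fin: "finite I"
    unfolding I_def using finite_support_finite[OF s] finite_support_finite[OF s'] by simp
  have [measurable]: "s \<in> borel_measurable \<mu>" "s' \<in> borel_measurable \<mu>"
    using s s' by (auto simp: finite_support_def intro: borel_measurable_simple_function)
  have sets: "A i \<in> sets \<mu>" for i
    unfolding A_def by measurable
  have em: "emeasure \<mu> (A i) < \<infinity>" if "i \<in> I" for i
  proof (cases "fst i = 0")
    case True
    then have "snd i \<noteq> 0" using that by (cases i) (auto simp: I_def)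
    from finite_support_level(2)[OF s' this] show ?thesis
      by (rule le_less_trans[rotated]) (auto simp: A_def intro!: emeasure_mono)
  next
    case False
    from finite_support_level(2)[OF s this] show ?thesis
      by (rule le_less_trans[rotated]) (auto simp: A_def intro!: emeasure_mono)
  qed
  have disj: "disjoint_family_on A I"
    by (auto simp: disjoint_family_on_def A_def)
  have off: "s x = 0 \<and> s' x = 0" if "x \<in> space \<mu> - (\<Union>i\<in>I. A i)" for x
  proof -
    have "(s x, s' x) \<notin> I"
      using that by (auto simp: A_def)
    then show ?thesis
      using that by (auto simp: I_def)
  qed
  note part = simple_noise_integral_partition[OF fin sets em disj]
  have "AE \<omega> in M. simple_noise_integral \<mu> H (\<lambda>x. a * s x + b * s' x) \<omega>
      = (\<Sum>i\<in>I. (a * fst i + b * snd i) * H (A i) \<omega>)"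
    by (rule part, assumption, simp add: A_def, drule off, simp)
  moreover have "AE \<omega> in M. simple_noise_integral \<mu> H s \<omega> = (\<Sum>i\<in>I. fst i * H (A i) \<omega>)"
    by (rule part, assumption, simp add: A_def, drule off, simp)
  moreover have "AE \<omega> in M. simple_noise_integral \<mu> H s' \<omega> = (\<Sum>i\<in>I. snd i * H (A i) \<omega>)"
    by (rule part, assumption, simp add: A_def, drule off, simp)
  ultimately show ?thesis
    by eventually_elim (simp add: sum_distrib_left sum.distrib distrib_right mult.assoc)
qed

text \<open>The values of the noise on the disjoint level sets are independent, so the characteristic function
  is a product of Gaussian ones.\<close>

lemma simple_noise_integral_char:
  assumes s: "finite_support s"
  shows "integrable \<mu> (\<lambda>x. (s x)\<^sup>2)"
    and "char (distr M borel (simple_noise_integral \<mu> H s)) \<theta> =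
      complex_of_real (exp (- (\<integral>x. (s x)\<^sup>2 \<partial>\<mu>) * \<theta>\<^sup>2 / 2))"
proof -
  define V where "V = s ` space \<mu> - {0}"
  define A where "A v = s -` {v} \<inter> space \<mu>" for v
  have fin: "finite V"
    using finite_support_finite[OF s] by (simp add: V_def)
  have sets: "A v \<in> sets \<mu>" and em: "emeasure \<mu> (A v) < \<infinity>" if "v \<in> V" for v
    using finite_support_level[OF s, of v] that by (auto simp: A_def V_def)
  have sq: "(s x)\<^sup>2 = (\<Sum>v\<in>V. v\<^sup>2 * indicator (A v) x)" if "x \<in> space \<mu>" for x
  proof (cases "s x = 0")
    case True
    then show ?thesis by (auto simp: A_def V_def indicator_def intro!: sum.neutral)
  next
    case False
    then have "s x \<in> V" using that by (auto simp: V_def)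
    then have "(\<Sum>v\<in>V. v\<^sup>2 * indicator (A v) x) = (\<Sum>v\<in>{s x}. v\<^sup>2 * indicator (A v) x)"
      by (intro sum.mono_neutral_right fin) (auto simp: A_def indicator_def)
    then show ?thesis using that by (simp add: A_def)
  qed
  have int: "integrable \<mu> (\<lambda>x. \<Sum>v\<in>V. v\<^sup>2 * indicator (A v) x)"
    by (intro Bochner_Integration.integrable_sum integrable_mult_right integrable_real_indicator sets em)
  then show "integrable \<mu> (\<lambda>x. (s x)\<^sup>2)"
    by (subst Bochner_Integration.integrable_cong[OF refl sq])
  have "(\<integral>x. (s x)\<^sup>2 \<partial>\<mu>) = (\<integral>x. (\<Sum>v\<in>V. v\<^sup>2 * indicator (A v) x) \<partial>\<mu>)"
    by (rule Bochner_Integration.integral_cong[OF refl sq])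
  also have "\<dots> = (\<Sum>v\<in>V. \<integral>x. v\<^sup>2 * indicator (A v) x \<partial>\<mu>)"
    by (intro Bochner_Integration.integral_sum integrable_mult_right integrable_real_indicator sets em)
  also have "\<dots> = (\<Sum>v\<in>V. v\<^sup>2 * measure \<mu> (A v))"
    using sets by (intro sum.cong refl) (simp add: A_def Int_absorb2 flip: Int_assoc)
  finally have var: "(\<integral>x. (s x)\<^sup>2 \<partial>\<mu>) = (\<Sum>v\<in>V. v\<^sup>2 * measure \<mu> (A v))" .
  \<comment> \<open>Independence is available for sequences of sets, so the level sets are enumerated and
    padded with empty sets.\<close>
  obtain g where g: "bij_betw g {0..<card V} V"
    using ex_bij_betw_nat_finite[OF fin] by blast
  define B where "B n = (if n < card V then A (g n) else {})" for n
  have gV: "g n \<in> V" if "n < card V" for n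
    using g that by (auto simp: bij_betw_def)
  have Bsets: "B n \<in> sets \<mu>" and Bem: "emeasure \<mu> (B n) < \<infinity>" for n
    using gV sets em by (auto simp: B_def)
  have "disjoint_family B"
    using bij_betw_imp_inj_on[OF g] by (auto simp: disjoint_family_on_def B_def A_def inj_on_def)
  then have "indep_vars (\<lambda>_. borel) (\<lambda>n. H (B n)) UNIV"
    using gaussian Bsets Bem unfolding gaussian_noise_def by blast
  then have "indep_vars (\<lambda>_. borel) (\<lambda>n. H (B n)) {0..<card V}"
    by (rule indep_vars_subset) auto
  then have indep: "indep_vars (\<lambda>_. borel) (\<lambda>n \<omega>. g n * H (B n) \<omega>) {0..<card V}"
    by (rule indep_vars_compose2) auto
  have "simple_noise_integral \<mu> H s = (\<lambda>\<omega>. \<Sum>n\<in>{0..<card V}. g n * H (B n) \<omega>)"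
    unfolding simple_noise_integral_def V_def[symmetric] A_def[symmetric]
    by (intro ext sum.reindex_bij_betw[OF g, symmetric, THEN trans] sum.cong) (auto simp: B_def)
  then have "char (distr M borel (simple_noise_integral \<mu> H s)) \<theta> =
      (\<Prod>n\<in>{0..<card V}. char (distr M borel (\<lambda>\<omega>. g n * H (B n) \<omega>)) \<theta>)"
    using char_distr_sum[OF indep] by simp
  also have "\<dots> = (\<Prod>n\<in>{0..<card V}. complex_of_real (exp (- ((g n)\<^sup>2 * measure \<mu> (A (g n))) * \<theta>\<^sup>2 / 2)))"
  proof (rule prod.cong[OF refl])
    fix n assume "n \<in> {0..<card V}"
    then have BA: "B n = A (g n)" by (simp add: B_def)
    have [measurable]: "H (B n) \<in> borel_measurable M"
      by (rule noise_measurable[OF Bsets Bem])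
    have "char (distr M borel (\<lambda>\<omega>. g n * H (B n) \<omega>)) \<theta> = char (distr M borel (H (B n))) (\<theta> * g n)"
      by (simp add: char_def integral_distr mult.assoc)
    then show "char (distr M borel (\<lambda>\<omega>. g n * H (B n) \<omega>)) \<theta> =
        complex_of_real (exp (- ((g n)\<^sup>2 * measure \<mu> (A (g n))) * \<theta>\<^sup>2 / 2))"
      unfolding noise_law[OF Bsets Bem] by (simp add: char_gaussian_law BA power_mult_distrib mult_ac)
  qed
  also have "\<dots> = complex_of_real (exp (\<Sum>n\<in>{0..<card V}. - ((g n)\<^sup>2 * measure \<mu> (A (g n))) * \<theta>\<^sup>2 / 2))"
    by (simp only: exp_sum[OF finite_atLeastLessThan] of_real_prod)
  also have "(\<Sum>n\<in>{0..<card V}. - ((g n)\<^sup>2 * measure \<mu> (A (g n))) * \<theta>\<^sup>2 / 2) =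
      (\<Sum>v\<in>V. - (v\<^sup>2 * measure \<mu> (A v)) * \<theta>\<^sup>2 / 2)"
    by (rule sum.reindex_bij_betw[OF g])
  also have "\<dots> = - (\<integral>x. (s x)\<^sup>2 \<partial>\<mu>) * \<theta>\<^sup>2 / 2"
    by (simp add: var sum_negf sum_distrib_right sum_divide_distrib)
  finally show "char (distr M borel (simple_noise_integral \<mu> H s)) \<theta> =
      complex_of_real (exp (- (\<integral>x. (s x)\<^sup>2 \<partial>\<mu>) * \<theta>\<^sup>2 / 2))" .
qed

text \<open>Simple integrals are Gaussian with variance the squared norm of the integrand. Both sides of this
  relation pass to the limit: the laws through convergence in $L^2(M)$, the variances through
  convergence in $L^2(\mu)$.\<close>

lemma noise_integral_law:
  assumes "is_noise_integral M \<mu> H f X"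
  shows "integrable \<mu> (\<lambda>x. (f x)\<^sup>2)" "distr M borel X = gaussian_law 0 (\<integral>x. (f x)\<^sup>2 \<partial>\<mu>)"
proof -
  from assms obtain s where [measurable]: "f \<in> borel_measurable \<mu>" "X \<in> borel_measurable M"
    and s: "\<And>n. finite_support (s n)"
    and f: "(\<lambda>n. \<integral>\<^sup>+x. ennreal ((s n x - f x)\<^sup>2) \<partial>\<mu>) \<longlonglongrightarrow> 0"
    and X: "(\<lambda>n. \<integral>\<^sup>+\<omega>. ennreal ((simple_noise_integral \<mu> H (s n) \<omega> - X \<omega>)\<^sup>2) \<partial>M) \<longlonglongrightarrow> 0"
    unfolding is_noise_integral_def finite_support_def by blast
  have [measurable]: "s n \<in> borel_measurable \<mu>" for n
    using s by (auto simp: finite_support_def intro: borel_measurable_simple_function)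
  note [measurable] = simple_noise_integral_measurable[OF s]
  note sq = square_integral_tendsto_of_L2[OF _ _ simple_noise_integral_char(1)[OF s] f]
  show "integrable \<mu> (\<lambda>x. (f x)\<^sup>2)" by (rule sq) auto
  show "distr M borel X = gaussian_law 0 (\<integral>x. (f x)\<^sup>2 \<partial>\<mu>)"
  proof (rule gaussian_law_eqI)
    fix \<theta>
    have "(\<lambda>n. char (distr M borel (simple_noise_integral \<mu> H (s n))) \<theta>) \<longlonglongrightarrow> char (distr M borel X) \<theta>"
      by (rule char_tendsto_of_L2[OF prob_space_axioms _ _ X]) auto
    moreover have "(\<lambda>n. char (distr M borel (simple_noise_integral \<mu> H (s n))) \<theta>) \<longlonglongrightarrow>
        complex_of_real (exp (- (\<integral>x. (f x)\<^sup>2 \<partial>\<mu>) * \<theta>\<^sup>2 / 2))"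
      unfolding simple_noise_integral_char(2)[OF s]
      by (intro tendsto_intros sq(2)) auto
    ultimately show "char (distr M borel X) \<theta> = complex_of_real (exp (- (\<integral>x. (f x)\<^sup>2 \<partial>\<mu>) * \<theta>\<^sup>2 / 2))"
      by (rule LIMSEQ_unique)
  qed (auto simp: prob_space_axioms)
qed

lemma noise_integral_lin:
  assumes "is_noise_integral M \<mu> H f X" "is_noise_integral M \<mu> H g Y"
  shows "is_noise_integral M \<mu> H (\<lambda>x. a * f x + b * g x) (\<lambda>\<omega>. a * X \<omega> + b * Y \<omega>)"
proof -
  from assms(1) obtain s where [measurable]: "f \<in> borel_measurable \<mu>" "X \<in> borel_measurable M"
    and s: "\<And>n. finite_support (s n)"
    and f: "(\<lambda>n. \<integral>\<^sup>+x. ennreal ((s n x - f x)\<^sup>2) \<partial>\<mu>) \<longlonglongrightarrow> 0"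
    and X: "(\<lambda>n. \<integral>\<^sup>+\<omega>. ennreal ((simple_noise_integral \<mu> H (s n) \<omega> - X \<omega>)\<^sup>2) \<partial>M) \<longlonglongrightarrow> 0"
    unfolding is_noise_integral_def finite_support_def by blast
  from assms(2) obtain s' where [measurable]: "g \<in> borel_measurable \<mu>" "Y \<in> borel_measurable M"
    and s': "\<And>n. finite_support (s' n)"
    and g: "(\<lambda>n. \<integral>\<^sup>+x. ennreal ((s' n x - g x)\<^sup>2) \<partial>\<mu>) \<longlonglongrightarrow> 0"
    and Y: "(\<lambda>n. \<integral>\<^sup>+\<omega>. ennreal ((simple_noise_integral \<mu> H (s' n) \<omega> - Y \<omega>)\<^sup>2) \<partial>M) \<longlonglongrightarrow> 0"
    unfolding is_noise_integral_def finite_support_def by blast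
  have [measurable]: "s n \<in> borel_measurable \<mu>" "s' n \<in> borel_measurable \<mu>" for n
    using s s' by (auto simp: finite_support_def intro: borel_measurable_simple_function)
  note [measurable] = simple_noise_integral_measurable[OF s] simple_noise_integral_measurable[OF s']
  define w where "w n x = a * s n x + b * s' n x" for n x
  have w: "finite_support (w n)" for n
    unfolding w_def[abs_def] by (rule finite_support_lin[OF s s'])
  have "(\<lambda>n. \<integral>\<^sup>+x. ennreal ((w n x - (a * f x + b * g x))\<^sup>2) \<partial>\<mu>) \<longlonglongrightarrow> 0"
    by (rule L2_lin_tendsto[OF _ _ _ _ f g]) (auto simp: w_def)
  moreover have "(\<lambda>n. \<integral>\<^sup>+\<omega>. ennreal ((simple_noise_integral \<mu> H (w n) \<omega> - (a * X \<omega> + b * Y \<omega>))\<^sup>2) \<partial>M) \<longlonglongrightarrow> 0"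
    by (rule L2_lin_tendsto[OF _ _ _ _ X Y])
      (auto simp: w_def[abs_def] intro: simple_noise_integral_lin[OF s s'])
  ultimately show ?thesis
    unfolding is_noise_integral_def finite_support_def[symmetric] using w by auto
qed

lemma noise_integral_zero: "is_noise_integral M \<mu> H (\<lambda>_. 0) (\<lambda>_. 0)"
proof -
  have "simple_noise_integral \<mu> H (\<lambda>_. 0) = (\<lambda>_. 0)"
    by (auto simp: simple_noise_integral_def fun_eq_iff intro!: sum.neutral)
  then show ?thesis
    unfolding is_noise_integral_def by (intro conjI exI[of _ "\<lambda>_ _. 0"]) auto
qed

lemma noise_integral_sum:
  assumes "finite F" "\<And>t. t \<in> F \<Longrightarrow> is_noise_integral M \<mu> H (f t) (X t)"
  shows "is_noise_integral M \<mu> H (\<lambda>x. \<Sum>t\<in>F. a t * f t x) (\<lambda>\<omega>. \<Sum>t\<in>F. a t * X t \<omega>)"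
  using assms
proof (induction F)
  case empty
  then show ?case using noise_integral_zero by simp
next
  case (insert t F)
  have "is_noise_integral M \<mu> H (\<lambda>x. a t * f t x + 1 * (\<Sum>t\<in>F. a t * f t x))
      (\<lambda>\<omega>. a t * X t \<omega> + 1 * (\<Sum>t\<in>F. a t * X t \<omega>))"
    by (rule noise_integral_lin) (use insert in auto)
  then show ?case using insert.hyps by simp
qed

lemma centered_gaussian_noise_integral:
  assumes "\<And>t. t \<ge> 0 \<Longrightarrow> is_noise_integral M \<mu> H (f t) (X t)"
  shows "centered_gaussian_process M X"
  unfolding centered_gaussian_process_def
proof (intro conjI allI impI)
  fix t :: real assume "t \<ge> 0"
  then show "X t \<in> borel_measurable M"
    using assms by (auto simp: is_noise_integral_def)
next
  fix F :: "real set" and a :: "real \<Rightarrow> real" assume F: "finite F \<and> F \<subseteq> {0..}"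
  have "is_noise_integral M \<mu> H (\<lambda>x. \<Sum>t\<in>F. a t * f t x) (\<lambda>\<omega>. \<Sum>t\<in>F. a t * X t \<omega>)"
    by (rule noise_integral_sum) (use F assms in auto)
  from noise_integral_law(2)[OF this]
  show "\<exists>v\<ge>0. distr M borel (\<lambda>\<omega>. \<Sum>t\<in>F. a t * X t \<omega>) = gaussian_law 0 v"
    by (intro exI[of _ "\<integral>x. (\<Sum>t\<in>F. a t * f t x)\<^sup>2 \<partial>\<mu>"]) auto
qed

text \<open>The law of \<open>X\<close> is then the point mass at 0, which is the Gaussian law with variance 0. This
  turns linear relations between the random variables into relations between the integrands.\<close>

lemma noise_integral_AE_zero:
  assumes X: "is_noise_integral M \<mu> H f X" and zero: "AE \<omega> in M. X \<omega> = 0"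
  shows "AE x in \<mu>. f x = 0"
proof -
  have [measurable]: "X \<in> borel_measurable M"
    using X by (auto simp: is_noise_integral_def)
  have "distr M borel X = distr M borel (\<lambda>_. 0)"
    by (rule distr_cong_AE) (use zero in auto)
  also have "\<dots> = gaussian_law 0 (\<integral>x. (0::real)\<^sup>2 \<partial>\<mu>)"
    using noise_integral_law(2)[OF noise_integral_zero] by simp
  finally have "(\<integral>x. (f x)\<^sup>2 \<partial>\<mu>) = 0"
    using noise_integral_law(2)[OF X] by (intro gaussian_law_inject) auto
  then have "AE x in \<mu>. (f x)\<^sup>2 = 0"
    using noise_integral_law(1)[OF X] by (subst (asm) integral_nonneg_eq_0_iff_AE) auto
  then show ?thesis by simp
qed

text \<open>The law of a single value is a centred Gaussian law and so determines its variance; hence the case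
  $q = 1$ of self-similarity already fixes the variance function up to a constant.\<close>

lemma self_similar_variance:
  assumes W: "\<And>t. t \<ge> 0 \<Longrightarrow> is_noise_integral M \<mu> H (f t) (X t)"
    and "self_similar M X \<eta>" "u > 0" "t \<ge> 0"
  shows "(\<integral>x. (f (u * t) x)\<^sup>2 \<partial>\<mu>) = u powr (2 * \<eta>) * (\<integral>x. (f t x)\<^sup>2 \<partial>\<mu>)"
proof -
  have [measurable]: "X t \<in> borel_measurable M" "X (u * t) \<in> borel_measurable M"
    using W \<open>u > 0\<close> \<open>t \<ge> 0\<close> by (auto simp: is_noise_integral_def)
  let ?P = "PiM {1..1::nat} (\<lambda>_. borel :: real measure)"
  have "distr M ?P (\<lambda>\<omega>. \<lambda>i\<in>{1..1}. X (u * t) \<omega>) = distr M ?P (\<lambda>\<omega>. \<lambda>i\<in>{1..1}. u powr \<eta> * X t \<omega>)"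
    using assms(2,3,4) unfolding self_similar_def
    by (elim allE[of _ u] impE allE[of _ 1] allE[of _ "\<lambda>_. t"]) auto
  then have "distr (distr M ?P (\<lambda>\<omega>. \<lambda>i\<in>{1..1}. X (u * t) \<omega>)) borel (\<lambda>x. x 1) =
      distr (distr M ?P (\<lambda>\<omega>. \<lambda>i\<in>{1..1}. u powr \<eta> * X t \<omega>)) borel (\<lambda>x. x 1)"
    by simp
  then have eq: "distr M borel (X (u * t)) = distr M borel (\<lambda>\<omega>. u powr \<eta> * X t \<omega>)"
    by (subst (asm) (1 2) distr_distr) (auto simp: comp_def)
  have "is_noise_integral M \<mu> H (\<lambda>x. u powr \<eta> * f t x + 0 * 0) (\<lambda>\<omega>. u powr \<eta> * X t \<omega> + 0 * 0)"
    by (rule noise_integral_lin[OF W[OF \<open>t \<ge> 0\<close>] noise_integral_zero])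
  then have "distr M borel (\<lambda>\<omega>. u powr \<eta> * X t \<omega>) = gaussian_law 0 (\<integral>x. (u powr \<eta> * f t x)\<^sup>2 \<partial>\<mu>)"
    using noise_integral_law(2) by fastforce
  moreover have "distr M borel (X (u * t)) = gaussian_law 0 (\<integral>x. (f (u * t) x)\<^sup>2 \<partial>\<mu>)"
    by (rule noise_integral_law(2)[OF W]) (use assms in auto)
  ultimately have "(\<integral>x. (f (u * t) x)\<^sup>2 \<partial>\<mu>) = (\<integral>x. (u powr \<eta> * f t x)\<^sup>2 \<partial>\<mu>)"
    using eq by (intro gaussian_law_inject) auto
  then show ?thesis
    using \<open>u > 0\<close> by (simp add: power_mult_distrib powr_power mult.commute)
qed

end

section \<open>Realizations of a graph as a geometric graph\<close>

text \<open>A bijection from the indices $0, \dots, k-1$ onto the vertices of \<open>\<Gamma>\<close> that exhibits the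
  geometric graph on the points \<open>x 0, ..., x (k - 1)\<close> as a copy of \<open>\<Gamma>\<close>.\<close>

definition labelling :: "'v graph \<Rightarrow> nat \<Rightarrow> real \<Rightarrow> (nat \<Rightarrow> 'v) \<Rightarrow> (nat \<Rightarrow> 'a::real_normed_vector) \<Rightarrow> bool"
  where
  "labelling \<Gamma> k t f x \<longleftrightarrow> bij_betw f {..<k} (verts \<Gamma>) \<and>
     (\<forall>i<k. \<forall>j<k. i \<noteq> j \<longrightarrow> x i \<noteq> x j \<and> ({f i, f j} \<in> edges \<Gamma> \<longleftrightarrow> norm (x i - x j) \<le> t))"

lemma simple_graph_edge:
  assumes "simple_graph \<Gamma>" "{u, v} \<in> edges \<Gamma>"
  shows "u \<in> verts \<Gamma>" "v \<in> verts \<Gamma>" "u \<noteq> v"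
  using assms unfolding simple_graph_def by (force simp: doubleton_eq_iff)+

lemma edges_geometric_graph:
  "{u, v} \<in> edges (geometric_graph X t) \<longleftrightarrow> u \<in> X \<and> v \<in> X \<and> u \<noteq> v \<and> norm (u - v) \<le> t"
  by (auto simp: geometric_graph_def edges_def doubleton_eq_iff norm_minus_commute)

lemma verts_geometric_graph: "verts (geometric_graph X t) = X"
  by (simp add: geometric_graph_def verts_def)

text \<open>An isomorphism onto a graph with $k$ vertices forces the $k$ listed points to be distinct, so it
  can be read as a labelling of the indices. Restricting to extensional labellings leaves a finite
  choice, and the condition becomes a finite Boolean combination of comparisons of distances. This
  is what makes the indicator measurable and stable under perturbation.\<close>

lemma geometric_graph_iso_iff:
  assumes \<Gamma>: "simple_graph \<Gamma>" "card (verts \<Gamma>) = k"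
  shows "graph_iso (geometric_graph (set (map x [0..<k])) t) \<Gamma> \<longleftrightarrow>
    (\<exists>f\<in>{..<k} \<rightarrow>\<^sub>E verts \<Gamma>. labelling \<Gamma> k t f x)"
proof
  have set: "set (map x [0..<k]) = x ` {..<k}" by auto
  assume "graph_iso (geometric_graph (set (map x [0..<k])) t) \<Gamma>"
  then obtain F where F: "bij_betw F (x ` {..<k}) (verts \<Gamma>)"
    and E: "\<And>u v. u \<in> x ` {..<k} \<Longrightarrow> v \<in> x ` {..<k} \<Longrightarrow>
      {u, v} \<in> edges (geometric_graph (x ` {..<k}) t) \<longleftrightarrow> {F u, F v} \<in> edges \<Gamma>"
    unfolding graph_iso_def set verts_geometric_graph by blast
  have "card (x ` {..<k}) = card {..<k}"
    using bij_betw_same_card[OF F] \<Gamma> by simp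
  then have inj: "inj_on x {..<k}"
    by (intro eq_card_imp_inj_on) auto
  define f where "f = restrict (F \<circ> x) {..<k}"
  have "bij_betw (F \<circ> x) {..<k} (verts \<Gamma>)"
    by (rule bij_betw_trans[OF _ F]) (use inj in \<open>simp add: bij_betw_def\<close>)
  then have bij: "bij_betw f {..<k} (verts \<Gamma>)"
    unfolding f_def by (subst bij_betw_cong[of _ _ "F \<circ> x"]) auto
  then have "f \<in> {..<k} \<rightarrow>\<^sub>E verts \<Gamma>"
    by (auto simp: f_def bij_betw_def)
  moreover have "labelling \<Gamma> k t f x"
    unfolding labelling_def
  proof (intro conjI allI impI bij)
    fix i j assume ij: "i < k" "j < k" "i \<noteq> j"
    show ne: "x i \<noteq> x j"
      using inj ij by (auto simp: inj_on_def)
    show "{f i, f j} \<in> edges \<Gamma> \<longleftrightarrow> norm (x i - x j) \<le> t"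
      using E[of "x i" "x j"] ij ne by (auto simp: f_def edges_geometric_graph)
  qed
  ultimately show "\<exists>f\<in>{..<k} \<rightarrow>\<^sub>E verts \<Gamma>. labelling \<Gamma> k t f x" by blast
next
  have set: "set (map x [0..<k]) = x ` {..<k}" by auto
  assume "\<exists>f\<in>{..<k} \<rightarrow>\<^sub>E verts \<Gamma>. labelling \<Gamma> k t f x"
  then obtain f where bij: "bij_betw f {..<k} (verts \<Gamma>)"
    and L: "\<And>i j. i < k \<Longrightarrow> j < k \<Longrightarrow> i \<noteq> j \<Longrightarrow>
        x i \<noteq> x j \<and> ({f i, f j} \<in> edges \<Gamma> \<longleftrightarrow> norm (x i - x j) \<le> t)"
    unfolding labelling_def by blast
  have inj: "inj_on x {..<k}"
    using L by (auto simp: inj_on_def)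
  define F where "F = f \<circ> the_inv_into {..<k} x"
  have Fx: "F (x i) = f i" if "i < k" for i
    using that inj by (simp add: F_def the_inv_into_f_f)
  show "graph_iso (geometric_graph (set (map x [0..<k])) t) \<Gamma>"
    unfolding graph_iso_def set verts_geometric_graph
  proof (intro exI[of _ F] conjI ballI)
    show "bij_betw F (x ` {..<k}) (verts \<Gamma>)"
      unfolding F_def by (rule bij_betw_trans[OF bij_betw_the_inv_into bij])
        (use inj in \<open>simp add: bij_betw_def\<close>)
    fix u v assume "u \<in> x ` {..<k}" "v \<in> x ` {..<k}"
    then obtain i j where ij: "i < k" "j < k" "u = x i" "v = x j" by auto
    show "{u, v} \<in> edges (geometric_graph (x ` {..<k}) t) \<longleftrightarrow> {F u, F v} \<in> edges \<Gamma>"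
    proof (cases "i = j")
      case True
      then show ?thesis
        using simple_graph_edge(3)[OF \<Gamma>(1), of "f i" "f i"] ij edges_geometric_graph[of u v]
        by (auto simp: Fx)
    next
      case False
      then show ?thesis
        using L[of i j] ij by (simp add: edges_geometric_graph Fx)
    qed
  qed
qed

lemma h_ind_map:
  assumes "simple_graph \<Gamma>" "card (verts \<Gamma>) = k"
  shows "h_ind \<Gamma> t (map x [0..<k]) = of_bool (\<exists>f\<in>{..<k} \<rightarrow>\<^sub>E verts \<Gamma>. labelling \<Gamma> k t f x)"
  unfolding h_ind_def using geometric_graph_iso_iff[OF assms, of x t] by simp

lemma h_ind_range: "0 \<le> h_ind \<Gamma> t xs" "h_ind \<Gamma> t xs \<le> 1"
  by (auto simp: h_ind_def)

lemma h_ind_measurable: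
  fixes x :: "nat \<Rightarrow> 'b \<Rightarrow> 'a::euclidean_space"
  assumes \<Gamma>: "simple_graph \<Gamma>" "card (verts \<Gamma>) = k"
    and [measurable]: "\<And>i. i < k \<Longrightarrow> x i \<in> borel_measurable N"
  shows "(\<lambda>\<omega>. h_ind \<Gamma> t (map (\<lambda>i. x i \<omega>) [0..<k])) \<in> borel_measurable N"
proof -
  have fin: "finite ({..<k} \<rightarrow>\<^sub>E verts \<Gamma>)"
    using \<Gamma> by (intro finite_PiE) (auto simp: simple_graph_def)
  have eq: "labelling \<Gamma> k t f y \<longleftrightarrow> bij_betw f {..<k} (verts \<Gamma>) \<and>
      (\<forall>i\<in>{..<k}. \<forall>j\<in>{..<k}. i \<noteq> j \<longrightarrow> y i \<noteq> y j \<and> ({f i, f j} \<in> edges \<Gamma> \<longleftrightarrow> norm (y i - y j) \<le> t))"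
    for f and y :: "nat \<Rightarrow> 'a" by (auto simp: labelling_def)
  have "Measurable.pred N (\<lambda>\<omega>. \<exists>f\<in>{..<k} \<rightarrow>\<^sub>E verts \<Gamma>. labelling \<Gamma> k t f (\<lambda>i. x i \<omega>))"
    unfolding eq using fin by measurable
  then show ?thesis
    unfolding h_ind_map[OF \<Gamma>] by measurable
qed

text \<open>Two vertices are joined by a path in \<open>\<Gamma>\<close>, and each edge bridges a distance of at most $t$. The
  number of edges, counted as ordered pairs, bounds the length of a shortest path, and it is at
  most $k^2$.\<close>

lemma h_ind_diameter:
  assumes \<Gamma>: "simple_graph \<Gamma>" "connected_graph \<Gamma>" "card (verts \<Gamma>) = k"
    and h: "h_ind \<Gamma> t (map x [0..<k]) \<noteq> 0" and t: "t \<ge> 0" and ij: "i < k" "j < k"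
  shows "norm (x i - x j) \<le> real (k * k) * t"
proof -
  obtain f where bij: "bij_betw f {..<k} (verts \<Gamma>)"
    and L: "\<And>i j. i < k \<Longrightarrow> j < k \<Longrightarrow> i \<noteq> j \<Longrightarrow>
        x i \<noteq> x j \<and> ({f i, f j} \<in> edges \<Gamma> \<longleftrightarrow> norm (x i - x j) \<le> t)"
    using h unfolding h_ind_map[OF \<Gamma>(1,3)] labelling_def by auto
  define y where "y = x \<circ> the_inv_into {..<k} f"
  have yf: "y (f i) = x i" if "i < k" for i
    using that bij by (simp add: y_def the_inv_into_f_f bij_betw_def)
  define R where "R = {(u, v). {u, v} \<in> edges \<Gamma>}"
  have R: "norm (y u - y v) \<le> t" if "(u, v) \<in> R" for u v
  proof -
    have uv: "u \<in> verts \<Gamma>" "v \<in> verts \<Gamma>" "u \<noteq> v"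
      using simple_graph_edge[OF \<Gamma>(1)] that by (auto simp: R_def)
    then obtain i j where "i < k" "j < k" "u = f i" "v = f j"
      using bij unfolding bij_betw_def by (metis imageE lessThan_iff)
    then show ?thesis using L[of i j] that uv yf by (auto simp: R_def)
  qed
  have sub: "R \<subseteq> verts \<Gamma> \<times> verts \<Gamma>"
    using simple_graph_edge[OF \<Gamma>(1)] by (auto simp: R_def)
  have finv: "finite (verts \<Gamma>)" using \<Gamma>(1) by (simp add: simple_graph_def)
  have fin: "finite R" using finite_subset[OF sub] finv by simp
  have card: "card R \<le> k * k"
    using card_mono[OF _ sub] finv \<Gamma>(3) by (simp add: card_cartesian_product)
  have path: "norm (y u - y v) \<le> real n * t" if "(u, v) \<in> R ^^ n" for n u v
    using that
  proof (induction n arbitrary: v)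
    case (Suc n)
    then obtain w where w: "(u, w) \<in> R ^^ n" "(w, v) \<in> R" by auto
    have "norm (y u - y v) \<le> norm (y u - y w) + norm (y w - y v)"
      by (metis norm_triangle_ineq diff_add_cancel add_diff_eq)
    then show ?case
      using Suc.IH[OF w(1)] R[OF w(2)] by (simp add: algebra_simps)
  qed simp
  have "f i \<in> verts \<Gamma>" "f j \<in> verts \<Gamma>"
    using bij ij by (auto simp: bij_betw_def)
  then have "(f i, f j) \<in> R\<^sup>*"
    using \<Gamma>(2) unfolding connected_graph_def R_def by blast
  then obtain n where n: "n \<le> card R" "(f i, f j) \<in> R ^^ n"
    unfolding rtrancl_finite_eq_relpow[OF fin] by auto
  have "norm (x i - x j) \<le> real n * t"
    using path[OF n(2)] ij by (simp add: yf)
  also have "\<dots> \<le> real (k * k) * t"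
    using n(1) card t by (intro mult_right_mono) (auto simp del: of_nat_mult)
  finally show ?thesis .
qed

lemma finite_positive_lower_bound:
  assumes "finite S" "\<And>x. x \<in> S \<Longrightarrow> (0::real) < g x"
  shows "\<exists>\<gamma>>0. \<forall>x\<in>S. \<gamma> \<le> g x"
  using assms
proof (induction S)
  case (insert a S)
  then obtain \<gamma> where "\<gamma> > 0" "\<forall>x\<in>S. \<gamma> \<le> g x" by auto
  then show ?case using insert.prems[of a] by (intro exI[of _ "min \<gamma> (g a)"]) auto
qed (auto intro: exI[of _ 1])

text \<open>Replacing the threshold $t_0$ of a given realization by a slightly larger one makes all
  comparisons strict, so that they survive a perturbation. Scaling then produces every threshold
  $t > 0$. A reflection at the origin and a small shift of the point with index 1 put that point
  strictly into the half-space $\langle e, x\rangle < 0$, without which no configuration need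
  violate the constraints in the integrands.\<close>

lemma open_realization:
  fixes X :: "'a::real_inner set" and e :: 'a
  assumes k: "k \<ge> 2" and \<Gamma>: "simple_graph \<Gamma>" "card (verts \<Gamma>) = k"
    and X: "finite X" "t\<^sub>0 \<ge> 0" "graph_iso (geometric_graph X t\<^sub>0) \<Gamma>"
    and t: "t > 0" and e: "norm e = 1"
  obtains p \<delta> where "\<delta> > 0"
    "\<And>x. x 0 = 0 \<Longrightarrow> (\<And>i. 0 < i \<Longrightarrow> i < k \<Longrightarrow> x i \<in> ball (p i) \<delta>) \<Longrightarrow>
       h_ind \<Gamma> t (map x [0..<k]) = 1 \<and> e \<bullet> x 1 \<le> - \<delta>"
proof -
  have "card X = k"
    using X(3) \<Gamma>(2) bij_betw_same_card unfolding graph_iso_def verts_geometric_graph by metis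
  then obtain q where q: "bij_betw q {0..<k} X"
    using ex_bij_betw_nat_finite[OF X(1)] by auto
  then have Xeq: "X = set (map q [0..<k])"
    by (auto simp: bij_betw_def)
  obtain f where f: "f \<in> {..<k} \<rightarrow>\<^sub>E verts \<Gamma>" "labelling \<Gamma> k t\<^sub>0 f q"
    using X(3) unfolding Xeq geometric_graph_iso_iff[OF \<Gamma>] by blast
  then have bij: "bij_betw f {..<k} (verts \<Gamma>)"
    and L: "\<And>i j. i < k \<Longrightarrow> j < k \<Longrightarrow> i \<noteq> j \<Longrightarrow>
        q i \<noteq> q j \<and> ({f i, f j} \<in> edges \<Gamma> \<longleftrightarrow> norm (q i - q j) \<le> t\<^sub>0)"
    unfolding labelling_def by blast+
  define S where "S = {(i, j). i < k \<and> j < k \<and> i \<noteq> j}"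
  have finS: "finite S"
    by (rule finite_subset[of _ "{..<k} \<times> {..<k}"]) (auto simp: S_def)
  define g where "g p = min (norm (q (fst p) - q (snd p)))
      (if {f (fst p), f (snd p)} \<in> edges \<Gamma> then 1 else (norm (q (fst p) - q (snd p)) - t\<^sub>0) / 2)" for p
  have gpos: "g p > 0" if "p \<in> S" for p
    using L[of "fst p" "snd p"] that by (cases p) (simp add: g_def S_def)
  obtain \<gamma> where \<gamma>: "\<gamma> > 0" and g: "\<And>p. p \<in> S \<Longrightarrow> \<gamma> \<le> g p"
    using finite_positive_lower_bound[OF finS, of g] gpos by blast
  have sep: "\<gamma> \<le> norm (q i - q j)" if "i < k" "j < k" "i \<noteq> j" for i j
    using g[of "(i, j)"] that by (simp add: g_def S_def)
  have nonedge: "t\<^sub>0 + 2 * \<gamma> \<le> norm (q i - q j)"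
    if "i < k" "j < k" "i \<noteq> j" "{f i, f j} \<notin> edges \<Gamma>" for i j
    using g[of "(i, j)"] that by (simp add: g_def S_def)
  \<comment> \<open>The new threshold $t_0 + \gamma$ lies at distance at least $\gamma$ from all pairwise
    distances; the factor $a$ scales it to $t$.\<close>
  define a where "a = t / (t\<^sub>0 + \<gamma>)"
  have a: "a > 0" and at: "a * (t\<^sub>0 + \<gamma>) = t"
    using X(2) \<gamma> t by (auto simp: a_def)
  define \<sigma> :: real where "\<sigma> = (if e \<bullet> (q 1 - q 0) \<le> 0 then 1 else - 1)"
  define p\<^sub>0 where "p\<^sub>0 i = (\<sigma> * a) *\<^sub>R (q i - q 0)" for i
  \<comment> \<open>Each point may move by $3\delta$, namely $2\delta$ for the shift and $\delta$ for the ball, so a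
    distance may change by $6\delta$, which has to be less than $a\gamma$.\<close>
  define \<delta> where "\<delta> = a * \<gamma> / 7"
  define p where "p i = (if i = 1 then p\<^sub>0 1 - (2 * \<delta>) *\<^sub>R e else p\<^sub>0 i)" for i
  have \<delta>: "\<delta> > 0" and \<gamma>\<delta>: "a * \<gamma> = 7 * \<delta>" using a \<gamma> by (auto simp: \<delta>_def)
  have p0: "norm (p\<^sub>0 i - p\<^sub>0 j) = a * norm (q i - q j)" for i j
  proof -
    have "p\<^sub>0 i - p\<^sub>0 j = (\<sigma> * a) *\<^sub>R (q i - q j)"
      by (simp add: p\<^sub>0_def algebra_simps)
    then show ?thesis using a by (simp add: \<sigma>_def abs_mult)
  qed
  show ?thesis
  proof (rule that[OF \<delta>])
    fix x assume x0: "x 0 = 0" and x: "\<And>i. 0 < i \<Longrightarrow> i < k \<Longrightarrow> x i \<in> ball (p i) \<delta>"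
    have near: "norm (x i - p\<^sub>0 i) \<le> 3 * \<delta>" if "i < k" for i
    proof (cases "i = 0")
      case True
      then show ?thesis using x0 \<delta> by (simp add: p\<^sub>0_def)
    next
      case False
      then have "norm (x i - p i) < \<delta>"
        using x that by (simp add: dist_norm norm_minus_commute)
      moreover have "norm (p i - p\<^sub>0 i) \<le> 2 * \<delta>"
        using e \<delta> by (auto simp: p_def)
      moreover have "norm (x i - p\<^sub>0 i) \<le> norm (x i - p i) + norm (p i - p\<^sub>0 i)"
        by (metis norm_triangle_ineq diff_add_cancel add_diff_eq)
      ultimately show ?thesis by simp
    qed
    have diff: "\<bar>norm (x i - x j) - a * norm (q i - q j)\<bar> \<le> 6 * \<delta>" if "i < k" "j < k" for i j
    proof -
      have "\<bar>norm (x i - x j) - norm (p\<^sub>0 i - p\<^sub>0 j)\<bar> \<le> norm ((x i - x j) - (p\<^sub>0 i - p\<^sub>0 j))"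
        by (rule norm_triangle_ineq3)
      also have "\<dots> = norm ((x i - p\<^sub>0 i) - (x j - p\<^sub>0 j))"
        by (simp add: algebra_simps)
      also have "\<dots> \<le> norm (x i - p\<^sub>0 i) + norm (x j - p\<^sub>0 j)"
        by (rule norm_triangle_ineq4)
      finally show ?thesis using near[OF that(1)] near[OF that(2)] by (simp add: p0)
    qed
    have "labelling \<Gamma> k t f x"
      unfolding labelling_def
    proof (intro conjI allI impI bij)
      fix i j assume ij: "i < k" "j < k" "i \<noteq> j"
      have "a * \<gamma> \<le> a * norm (q i - q j)"
        using sep[OF ij] a by (intro mult_left_mono) auto
      then have "norm (x i - x j) > 0"
        using diff[OF ij(1,2)] \<gamma>\<delta> \<delta> by linarith
      then show "x i \<noteq> x j" by auto
      show "{f i, f j} \<in> edges \<Gamma> \<longleftrightarrow> norm (x i - x j) \<le> t"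
      proof
        assume "{f i, f j} \<in> edges \<Gamma>"
        then have "a * norm (q i - q j) \<le> a * t\<^sub>0"
          using L[OF ij] a by (intro mult_left_mono) auto
        moreover have "a * t\<^sub>0 + a * \<gamma> = t"
          using at by (simp add: algebra_simps)
        ultimately show "norm (x i - x j) \<le> t"
          using diff[OF ij(1,2)] \<gamma>\<delta> \<delta> by linarith
      next
        assume le: "norm (x i - x j) \<le> t"
        show "{f i, f j} \<in> edges \<Gamma>"
        proof (rule ccontr)
          assume "{f i, f j} \<notin> edges \<Gamma>"
          then have "a * (t\<^sub>0 + 2 * \<gamma>) \<le> a * norm (q i - q j)"
            using nonedge[OF ij] a by (intro mult_left_mono) auto
          moreover have "a * (t\<^sub>0 + 2 * \<gamma>) = t + a * \<gamma>"
            using at by (simp add: algebra_simps)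
          ultimately show False
            using diff[OF ij(1,2)] \<gamma>\<delta> \<delta> le by linarith
        qed
      qed
    qed
    then have "h_ind \<Gamma> t (map x [0..<k]) = 1"
      unfolding h_ind_map[OF \<Gamma>] using f(1) by auto
    moreover have "e \<bullet> x 1 \<le> - \<delta>"
    proof -
      have "e \<bullet> p\<^sub>0 1 \<le> 0"
        using a by (auto simp: p\<^sub>0_def \<sigma>_def mult_le_0_iff)
      moreover have "e \<bullet> e = 1"
        using e by (simp add: norm_eq_1)
      ultimately have "e \<bullet> p 1 \<le> - 2 * \<delta>"
        by (simp add: p_def inner_diff_right)
      moreover have "norm (x 1 - p 1) < \<delta>"
        using x[of 1] k by (simp add: dist_norm norm_minus_commute)
      moreover have "e \<bullet> (x 1 - p 1) \<le> norm (x 1 - p 1)"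
        using norm_cauchy_schwarz[of e "x 1 - p 1"] e by simp
      ultimately show ?thesis by (simp add: inner_diff_right)
    qed
    ultimately show "h_ind \<Gamma> t (map x [0..<k]) = 1 \<and> e \<bullet> x 1 \<le> - \<delta>" by blast
  qed
qed

section \<open>Exponential weights on half-spaces\<close>

text \<open>The weight of a single point: the exponential on the half-space where its exponent is
  non-positive, cut off at the box of half-side $r$.\<close>

definition tilt :: "real \<Rightarrow> 'a::euclidean_space \<Rightarrow> real \<Rightarrow> real \<Rightarrow> 'a \<Rightarrow> ennreal" where
  "tilt c e r \<rho> x = ennreal (exp (- (\<rho> + (1 / c) * (e \<bullet> x))) * of_bool (\<rho> + (1 / c) * (e \<bullet> x) \<ge> 0)) *
     indicator {x. \<forall>b\<in>Basis. \<bar>x \<bullet> b\<bar> \<le> r} x"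

definition tilt_bound :: "'a::euclidean_space itself \<Rightarrow> real \<Rightarrow> real \<Rightarrow> real" where
  "tilt_bound TYPE('a) c r = min (2 * r) c * (2 * r) ^ (DIM('a) - 1)"

lemma tilt_measurable [measurable]:
  assumes [measurable]: "f \<in> borel_measurable N" "g \<in> borel_measurable N"
  shows "(\<lambda>\<omega>. tilt c e r (f \<omega>) (g \<omega>)) \<in> borel_measurable N"
  unfolding tilt_def by measurable

lemma nn_integral_exp_half_line:
  assumes c: "c > 0"
  shows "(\<integral>\<^sup>+s. ennreal (exp (- (\<rho> + (1 / c) * s)) * of_bool (\<rho> + (1 / c) * s \<ge> 0)) \<partial>lborel) = ennreal c"
proof -
  have "(\<integral>\<^sup>+s. ennreal (exp (- (\<rho> + (1 / c) * s)) * of_bool (\<rho> + (1 / c) * s \<ge> 0)) \<partial>lborel)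
      = (\<integral>\<^sup>+s. ennreal (exp (- (\<rho> + (1 / c) * s))) * indicator {- c * \<rho>..} s \<partial>lborel)"
    using c by (intro nn_integral_cong) (auto simp: field_simps indicator_def)
  also have "\<dots> = ennreal (0 - (- c * exp (- (\<rho> + (1 / c) * (- c * \<rho>)))))"
  proof (rule nn_integral_FTC_atLeast)
    show "((\<lambda>s. - c * exp (- (\<rho> + (1 / c) * s))) has_real_derivative exp (- (\<rho> + (1 / c) * s))) (at s)" for s
      using c by (auto intro!: derivative_eq_intros)
    have "filterlim (\<lambda>s. \<rho> + (1 / c) * s) at_top at_top"
      using c by (intro filterlim_tendsto_add_at_top[OF tendsto_const]
          filterlim_tendsto_pos_mult_at_top[OF tendsto_const] filterlim_ident) auto
    then have "((\<lambda>s. exp (- (\<rho> + (1 / c) * s))) \<longlongrightarrow> 0) at_top"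
      by (intro filterlim_compose[OF exp_at_bot] filterlim_compose[OF filterlim_uminus_at_bot_at_top])
    from tendsto_mult_left[OF this, of "- c"]
    show "((\<lambda>s. - c * exp (- (\<rho> + (1 / c) * s))) \<longlongrightarrow> 0) at_top" by simp
  qed auto
  finally show ?thesis using c by simp
qed

text \<open>The integral factorizes over the coordinates. In the direction \<open>e\<close> the weight is bounded by 1 on an
  interval of length $2r$ and has total integral $c$ over the half-line, whence the minimum; in each
  other direction the box contributes $2r$.\<close>

lemma nn_integral_tilt_le:
  fixes e :: "'a::euclidean_space"
  assumes e: "e \<in> Basis" and c: "c > 0" and r: "r \<ge> 0"
  shows "(\<integral>\<^sup>+x. tilt c e r \<rho> x \<partial>lborel) \<le> ennreal (tilt_bound TYPE('a) c r)"
proof -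
  define E where "E s = ennreal (exp (- (\<rho> + (1 / c) * s)) * of_bool (\<rho> + (1 / c) * s \<ge> 0))" for s
  define F where "F b s = (if b = e then E s else 1) * indicator {- r..r} s" for b :: 'a and s
  have [measurable]: "E \<in> borel_measurable borel" unfolding E_def[abs_def] by measurable
  have "tilt c e r \<rho> x = (\<Prod>b\<in>Basis. F b (x \<bullet> b))" for x
  proof -
    have "(\<Prod>b\<in>Basis. F b (x \<bullet> b)) = (\<Prod>b\<in>Basis. if b = e then E (x \<bullet> b) else 1) *
        (\<Prod>b\<in>Basis. indicator {- r..r} (x \<bullet> b))"
      unfolding F_def by (rule prod.distrib)
    also have "(\<Prod>b\<in>Basis. if b = e then E (x \<bullet> b) else 1) = E (e \<bullet> x)"
      using e by (simp add: inner_commute)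
    also have "(\<Prod>b\<in>Basis. indicator {- r..r} (x \<bullet> b)) =
        (indicator {x. \<forall>b\<in>Basis. \<bar>x \<bullet> b\<bar> \<le> r} x :: ennreal)"
    proof (cases "\<forall>b\<in>Basis. \<bar>x \<bullet> b\<bar> \<le> r")
      case True
      then show ?thesis by (intro trans[OF prod.neutral]) (auto simp: abs_le_iff)
    next
      case False
      then obtain b where "b \<in> Basis" "indicator {- r..r} (x \<bullet> b) = (0 :: ennreal)"
        by (auto simp: abs_le_iff)
      then have "(\<Prod>b\<in>Basis. indicator {- r..r} (x \<bullet> b)) = (0 :: ennreal)"
        by (intro prod_zero) auto
      with False show ?thesis by simp
    qed
    finally show ?thesis by (simp add: tilt_def E_def)
  qed
  then have "(\<integral>\<^sup>+x. tilt c e r \<rho> x \<partial>lborel) = (\<integral>\<^sup>+x. (\<Prod>b\<in>Basis. F b (x \<bullet> b)) \<partial>lborel)" by simp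
  also have "\<dots> = (\<Prod>b\<in>Basis. \<integral>\<^sup>+s. F b s \<partial>lborel)"
    by (rule nn_integral_lborel_prod) (auto simp: F_def[abs_def])
  also have "\<dots> = (\<integral>\<^sup>+s. F e s \<partial>lborel) * (\<Prod>b\<in>Basis - {e}. \<integral>\<^sup>+s. F b s \<partial>lborel)"
    using e by (simp add: prod.remove)
  also have "(\<Prod>b\<in>Basis - {e}. \<integral>\<^sup>+s. F b s \<partial>lborel) = ennreal (2 * r) ^ (DIM('a) - 1)"
    using e r by (simp add: F_def card_Diff_singleton)
  also have "(\<integral>\<^sup>+s. F e s \<partial>lborel) \<le> ennreal (min (2 * r) c)"
  proof -
    have "(\<integral>\<^sup>+s. F e s \<partial>lborel) \<le> (\<integral>\<^sup>+s. E s \<partial>lborel)"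
      by (intro nn_integral_mono) (auto simp: F_def indicator_def)
    also have "\<dots> = ennreal c"
      unfolding E_def by (rule nn_integral_exp_half_line[OF c])
    finally have 1: "(\<integral>\<^sup>+s. F e s \<partial>lborel) \<le> ennreal c" .
    have "E s \<le> 1" for s by (auto simp: E_def)
    then have "(\<integral>\<^sup>+s. F e s \<partial>lborel) \<le> (\<integral>\<^sup>+s. indicator {- r..r} s \<partial>lborel)"
      by (intro nn_integral_mono) (auto simp: F_def indicator_def)
    also have "\<dots> = ennreal (2 * r)" using r by simp
    finally show ?thesis using 1 by (simp add: min_def)
  qed
  also have "ennreal (min (2 * r) c) * ennreal (2 * r) ^ (DIM('a) - 1) = ennreal (tilt_bound TYPE('a) c r)"
    using r c unfolding tilt_bound_def by (subst ennreal_power, simp, subst ennreal_mult) auto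
  finally show ?thesis
    by (simp add: mult_right_mono)
qed

interpretation lborel_product: product_sigma_finite "\<lambda>_ :: nat. lborel :: 'a::euclidean_space measure"
  by standard

lemma nn_integral_prod_tilt_le:
  fixes e :: "'a::euclidean_space"
  assumes "e \<in> Basis" "c > 0" "r \<ge> 0" "finite I"
  shows "(\<integral>\<^sup>+z. (\<Prod>i\<in>I. tilt c e r \<rho> (z i)) \<partial>PiM I (\<lambda>_ :: nat. lborel)) \<le> ennreal (tilt_bound TYPE('a) c r) ^ card I"
proof -
  have "(\<integral>\<^sup>+z. (\<Prod>i\<in>I. tilt c e r \<rho> (z i)) \<partial>PiM I (\<lambda>_ :: nat. lborel)) =
      (\<Prod>i\<in>I. \<integral>\<^sup>+x. tilt c e r \<rho> x \<partial>lborel)"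
    by (rule lborel_product.product_nn_integral_prod) (use assms in auto)
  also have "\<dots> \<le> (\<Prod>i\<in>I. ennreal (tilt_bound TYPE('a) c r))"
    by (intro prod_mono_ennreal nn_integral_tilt_le assms)
  finally show ?thesis by simp
qed

lemma emeasure_ball_neq_0:
  "\<delta> > 0 \<Longrightarrow> emeasure lborel (ball (p :: 'a::euclidean_space) \<delta>) \<noteq> 0"
  using content_ball_pos[of \<delta> p] by (auto simp: measure_def)

text \<open>Products of balls have positive measure, so a property that holds almost everywhere holds
  somewhere in them.\<close>

lemma AE_PiM_balls:
  fixes p :: "nat \<Rightarrow> 'a::euclidean_space"
  assumes "AE z in PiM I (\<lambda>_. lborel). P z" "finite I" "\<delta> > 0"
  obtains z where "\<And>i. i \<in> I \<Longrightarrow> z i \<in> ball (p i) \<delta>" "P z"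
proof -
  let ?S = "Pi\<^sub>E I (\<lambda>i. ball (p i) \<delta>)"
  have S: "?S \<in> sets (PiM I (\<lambda>_. lborel))"
    by (rule sets_PiM_I_finite) (use assms in auto)
  have "emeasure (PiM I (\<lambda>_. lborel)) ?S = (\<Prod>i\<in>I. emeasure lborel (ball (p i) \<delta>))"
    by (rule lborel_product.emeasure_PiM) (use assms in auto)
  then have "emeasure (PiM I (\<lambda>_. lborel)) ?S \<noteq> 0"
    using \<open>\<delta> > 0\<close> \<open>finite I\<close> by (simp add: emeasure_ball_neq_0)
  moreover have "emeasure (PiM I (\<lambda>_. lborel)) ?S = 0" if "\<forall>z\<in>?S. \<not> P z"
  proof -
    have "AE z in PiM I (\<lambda>_. lborel). z \<notin> ?S"
      using assms(1) by eventually_elim (use that in blast)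
    then show ?thesis
      using S by (simp add: AE_iff_null_sets null_setsD1)
  qed
  ultimately obtain z where "z \<in> ?S" "P z" by blast
  then show ?thesis
    using that by (auto simp: PiE_iff)
qed

section \<open>The integrands\<close>

text \<open>The configuration in which the origin comes first, then the $\ell - 1$ points \<open>y\<close>, which are
  indexed from 1, then the points \<open>z\<close>, again indexed from 1.\<close>

definition points :: "nat \<Rightarrow> (nat \<Rightarrow> 'a::zero) \<Rightarrow> (nat \<Rightarrow> 'a) \<Rightarrow> nat \<Rightarrow> 'a" where
  "points l y z i = (if i = 0 then 0 else if i < l then y i else z (i - l + 1))"

lemma list_eq_points:
  assumes "l \<in> {1..k}"
  shows "0 # map y [1..<l] @ map z [1..<Suc (k - l)] = map (points l y z) [0..<k]"
proof (rule nth_equalityI)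
  fix i assume "i < length (0 # map y [1..<l] @ map z [1..<Suc (k - l)])"
  then show "(0 # map y [1..<l] @ map z [1..<Suc (k - l)]) ! i = map (points l y z) [0..<k] ! i"
    using assms by (cases i) (auto simp: points_def nth_append Suc_diff_le simp del: upt_Suc)
qed (use assms in auto)

locale config =
  fixes \<Gamma> :: "'v graph" and k :: nat and e :: "real ^ 'd::finite" and c :: real
  assumes k: "k \<ge> 2"
    and simple: "simple_graph \<Gamma>" and connected: "connected_graph \<Gamma>" and card: "card (verts \<Gamma>) = k"
    and feasible: "\<exists>(X :: (real ^ 'd) set) t. finite X \<and> t \<ge> 0 \<and> graph_iso (geometric_graph X t) \<Gamma>"
    and e: "e \<in> Basis" and c: "c > 0"
begin

definition kernel :: "nat \<Rightarrow> real \<Rightarrow> real \<Rightarrow> (nat \<Rightarrow> real ^ 'd) \<Rightarrow> (nat \<Rightarrow> real ^ 'd) \<Rightarrow> real" where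
  "kernel l t \<rho> y z = exp (- (\<Sum>i = 1..k - l. \<rho> + (1 / c) * (e \<bullet> z i))) *
     of_bool (\<forall>i\<in>{1..k - l}. \<rho> + (1 / c) * (e \<bullet> z i) \<ge> 0) * h_ind \<Gamma> t (map (points l y z) [0..<k])"

text \<open>By \<open>h_ind_diameter\<close>, every point of a configuration at threshold $t$ that contains the origin
  lies within this distance of the origin.\<close>

abbreviation radius :: "real \<Rightarrow> real" where
  "radius t \<equiv> real (k * k) * t"

lemma W_integrand_eq:
  "l \<in> {1..k} \<Longrightarrow> W_integrand \<Gamma> k e c l t (\<rho>, y) = (\<integral>z. kernel l t \<rho> y z \<partial>PiM {1..k - l} (\<lambda>_. lborel))"
  unfolding W_integrand_def kernel_def by (simp only: list_eq_points prod.case)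

lemma kernel_nonneg: "0 \<le> kernel l t \<rho> y z"
  by (simp add: kernel_def h_ind_range)

lemma kernel_measurable:
  assumes "l \<in> {1..k}"
  shows "kernel l t \<rho> y \<in> borel_measurable (PiM {1..k - l} (\<lambda>_. lborel))"
proof -
  have comp [measurable]: "(\<lambda>z. z i) \<in> borel_measurable (PiM {1..k - l} (\<lambda>_. lborel :: (real ^ 'd) measure))"
    if "i \<in> {1..k - l}" for i
    using measurable_component_singleton[OF that, of "\<lambda>_. lborel :: (real ^ 'd) measure"] by simp
  have [measurable]: "(\<lambda>z. points l y z i) \<in> borel_measurable (PiM {1..k - l} (\<lambda>_. lborel))" if "i < k" for i
  proof -
    have "(\<lambda>z. z (i - l + 1)) \<in> borel_measurable (PiM {1..k - l} (\<lambda>_. lborel :: (real ^ 'd) measure))"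
      if "\<not> i < l"
      by (rule comp) (use that \<open>i < k\<close> assms in auto)
    then show ?thesis
      by (cases "i = 0"; cases "i < l") (simp_all add: points_def)
  qed
  have [measurable]: "(\<lambda>z. h_ind \<Gamma> t (map (points l y z) [0..<k])) \<in> borel_measurable (PiM {1..k - l} (\<lambda>_. lborel))"
    by (rule h_ind_measurable[OF simple card, of "\<lambda>i z. points l y z i"]) measurable
  show ?thesis
    unfolding kernel_def[abs_def] by measurable
qed

lemma points_near:
  assumes "h_ind \<Gamma> t (map (points l y z) [0..<k]) \<noteq> 0" "t \<ge> 0" "l \<in> {1..k}"
  shows "i \<in> {1..l - 1} \<Longrightarrow> norm (y i) \<le> radius t" "j \<in> {1..k - l} \<Longrightarrow> norm (z j) \<le> radius t"
proof -
  note near = h_ind_diameter[OF simple connected card assms(1,2)]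
  show "norm (y i) \<le> radius t" if "i \<in> {1..l - 1}"
  proof -
    have "i < l" "i < k" "i \<noteq> 0" using that assms(3) by auto
    then show ?thesis using near[of i 0] k by (simp add: points_def)
  qed
  show "norm (z j) \<le> radius t" if "j \<in> {1..k - l}"
  proof -
    have "l + j - 1 < k" "\<not> l + j - 1 < l" "l + j - 1 \<noteq> 0" "l + j - 1 - l + 1 = j"
      using that assms(3) by auto
    then show ?thesis using near[of "l + j - 1" 0] k by (simp add: points_def)
  qed
qed

text \<open>Where the kernel does not vanish, all points lie in the box and in the half-spaces, and the
  right-hand side is just the exponential.\<close>

lemma kernel_le:
  assumes "t \<ge> 0" "l \<in> {1..k}"
  shows "ennreal (kernel l t \<rho> y z) \<le>
    (\<Prod>i\<in>{1..k - l}. tilt c e (radius t) \<rho> (z i)) *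
    (\<Prod>i\<in>{1..l - 1}. indicator {x. \<forall>b\<in>Basis. \<bar>x \<bullet> b\<bar> \<le> radius t} (y i))"
proof (cases "kernel l t \<rho> y z = 0")
  case False
  then have h: "h_ind \<Gamma> t (map (points l y z) [0..<k]) \<noteq> 0"
    and pos: "\<And>i. i \<in> {1..k - l} \<Longrightarrow> \<rho> + (1 / c) * (e \<bullet> z i) \<ge> 0"
    by (auto simp: kernel_def)
  have box: "\<forall>b\<in>Basis. \<bar>x \<bullet> b\<bar> \<le> radius t" if "norm x \<le> radius t" for x :: "real ^ 'd"
    using that Basis_le_norm order_trans by blast
  have "(\<Prod>i\<in>{1..l - 1}. indicator {x. \<forall>b\<in>Basis. \<bar>x \<bullet> b\<bar> \<le> radius t} (y i)) = (1 :: ennreal)"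
    using box[OF points_near(1)[OF h assms]] by (intro prod.neutral) auto
  moreover have "(\<Prod>i\<in>{1..k - l}. tilt c e (radius t) \<rho> (z i)) =
      (\<Prod>i\<in>{1..k - l}. ennreal (exp (- (\<rho> + (1 / c) * (e \<bullet> z i)))))"
    using box[OF points_near(2)[OF h assms]] pos by (intro prod.cong) (auto simp: tilt_def)
  moreover have "\<dots> = ennreal (exp (- (\<Sum>i = 1..k - l. \<rho> + (1 / c) * (e \<bullet> z i))))"
    by (simp add: prod_ennreal exp_sum flip: sum_negf)
  moreover have "kernel l t \<rho> y z \<le> exp (- (\<Sum>i = 1..k - l. \<rho> + (1 / c) * (e \<bullet> z i)))"
    unfolding kernel_def using h_ind_range(2)[of \<Gamma> t] by (auto simp: mult_left_le h_ind_range)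
  ultimately show ?thesis by (simp add: ennreal_leI)
qed simp

lemma nn_integral_kernel_le:
  assumes "t \<ge> 0" "l \<in> {1..k}"
  shows "(\<integral>\<^sup>+z. ennreal (kernel l t \<rho> y z) \<partial>PiM {1..k - l} (\<lambda>_. lborel)) \<le>
    ennreal (tilt_bound TYPE(real ^ 'd) c (radius t)) ^ (k - l) *
    (\<Prod>i\<in>{1..l - 1}. indicator {x. \<forall>b\<in>Basis. \<bar>x \<bullet> b\<bar> \<le> radius t} (y i))"
proof -
  let ?B = "(\<Prod>i\<in>{1..l - 1}. indicator {x. \<forall>b\<in>Basis. \<bar>x \<bullet> b\<bar> \<le> radius t} (y i)) :: ennreal"
  have "(\<integral>\<^sup>+z. ennreal (kernel l t \<rho> y z) \<partial>PiM {1..k - l} (\<lambda>_. lborel)) \<le>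
      (\<integral>\<^sup>+z. (\<Prod>i\<in>{1..k - l}. tilt c e (radius t) \<rho> (z i)) * ?B \<partial>PiM {1..k - l} (\<lambda>_. lborel))"
    by (intro nn_integral_mono kernel_le assms)
  also have "\<dots> = (\<integral>\<^sup>+z. (\<Prod>i\<in>{1..k - l}. tilt c e (radius t) \<rho> (z i)) \<partial>PiM {1..k - l} (\<lambda>_. lborel)) * ?B"
    by (rule nn_integral_multc) measurable
  also have "\<dots> \<le> ennreal (tilt_bound TYPE(real ^ 'd) c (radius t)) ^ card {1..k - l} * ?B"
    by (intro mult_right_mono nn_integral_prod_tilt_le e c) (use assms in auto)
  finally show ?thesis by simp
qed

lemma kernel_integrable:
  assumes "t \<ge> 0" "l \<in> {1..k}"
  shows "integrable (PiM {1..k - l} (\<lambda>_. lborel)) (kernel l t \<rho> y)"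
proof (rule integrableI_bounded)
  have "(\<Prod>i\<in>{1..l - 1}. indicator {x. \<forall>b\<in>Basis. \<bar>x \<bullet> b\<bar> \<le> radius t} (y i)) \<le> (\<Prod>i\<in>{1..l - 1}. 1 :: ennreal)"
    by (intro prod_mono_ennreal) (auto simp: indicator_def)
  then have "(\<integral>\<^sup>+z. ennreal (kernel l t \<rho> y z) \<partial>PiM {1..k - l} (\<lambda>_. lborel)) \<le>
      ennreal (tilt_bound TYPE(real ^ 'd) c (radius t)) ^ (k - l) * (\<Prod>i\<in>{1..l - 1}. 1)"
    by (intro order_trans[OF nn_integral_kernel_le[OF assms, of \<rho> y]] mult_left_mono) auto
  also have "\<dots> < \<infinity>"
    by (simp add: power_less_top_ennreal)
  finally show "(\<integral>\<^sup>+z. ennreal (norm (kernel l t \<rho> y z)) \<partial>PiM {1..k - l} (\<lambda>_. lborel)) < \<infinity>"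
    using kernel_nonneg by simp
qed (rule kernel_measurable[OF assms(2)])

lemma W_integrand_le:
  assumes "t \<ge> 0" "l \<in> {1..k}"
  shows "ennreal (W_integrand \<Gamma> k e c l t (\<rho>, y)) \<le>
    ennreal (tilt_bound TYPE(real ^ 'd) c (radius t)) ^ (k - l) *
    (\<Prod>i\<in>{1..l - 1}. indicator {x. \<forall>b\<in>Basis. \<bar>x \<bullet> b\<bar> \<le> radius t} (y i))"
  unfolding W_integrand_eq[OF assms(2)]
  using nn_integral_kernel_le[OF assms, of \<rho> y]
  by (subst nn_integral_eq_integral[OF kernel_integrable[OF assms] AE_I2, symmetric]) (auto simp: kernel_nonneg)

lemma W_integrand_nonneg: "l \<in> {1..k} \<Longrightarrow> 0 \<le> W_integrand \<Gamma> k e c l t x"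
  by (cases x) (simp add: W_integrand_eq kernel_nonneg)

lemma realization:
  assumes "t > 0"
  obtains p \<delta> where "\<delta> > 0"
    "\<And>l y z. l \<in> {1..k} \<Longrightarrow> (\<And>i. i \<in> {1..l - 1} \<Longrightarrow> y i \<in> ball (p i) \<delta>) \<Longrightarrow>
      (\<And>j. j \<in> {1..k - l} \<Longrightarrow> z j \<in> ball (p (l + j - 1)) \<delta>) \<Longrightarrow>
      h_ind \<Gamma> t (map (points l y z) [0..<k]) = 1 \<and> e \<bullet> points l y z 1 \<le> - \<delta>"
proof -
  obtain X :: "(real ^ 'd) set" and t\<^sub>0 where "finite X" "t\<^sub>0 \<ge> 0" "graph_iso (geometric_graph X t\<^sub>0) \<Gamma>"
    using feasible by blast
  from open_realization[OF k simple card this \<open>t > 0\<close>] e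
  obtain p \<delta> where \<delta>: "\<delta> > 0" and x: "\<And>x. x 0 = 0 \<Longrightarrow> (\<And>i. 0 < i \<Longrightarrow> i < k \<Longrightarrow> x i \<in> ball (p i) \<delta>) \<Longrightarrow>
       h_ind \<Gamma> t (map x [0..<k]) = 1 \<and> e \<bullet> x 1 \<le> - \<delta>"
    using norm_Basis by metis
  show ?thesis
  proof (rule that[OF \<delta>])
    fix l y z assume l: "l \<in> {1..k}" and y: "\<And>i. i \<in> {1..l - 1} \<Longrightarrow> y i \<in> ball (p i) \<delta>"
      and z: "\<And>j. j \<in> {1..k - l} \<Longrightarrow> z j \<in> ball (p (l + j - 1)) \<delta>"
    show "h_ind \<Gamma> t (map (points l y z) [0..<k]) = 1 \<and> e \<bullet> points l y z 1 \<le> - \<delta>"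
    proof (rule x)
      fix i assume i: "0 < i" "i < k"
      show "points l y z i \<in> ball (p i) \<delta>"
      proof (cases "i < l")
        case True
        then show ?thesis using y[of i] i by (simp add: points_def)
      next
        case False
        then show ?thesis using z[of "i - l + 1"] i l by (simp add: points_def)
      qed
    qed (simp add: points_def)
  qed
qed

text \<open>For $\rho$ at least $1/c$ times the radius, the half-space constraints do not restrict the
  configurations.\<close>

lemma in_half_space:
  assumes "norm x \<le> R" "R \<le> c * \<rho>"
  shows "\<rho> + (1 / c) * (e \<bullet> x) \<ge> 0"
proof -
  have "\<bar>e \<bullet> x\<bar> \<le> R"
    using Basis_le_norm[OF e, of x] assms(1) by (simp add: inner_commute)
  then have "c * \<rho> + e \<bullet> x \<ge> 0" using assms(2) by linarith
  then show ?thesis using c by (simp add: field_simps)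
qed

text \<open>For large $\rho$ the half-space constraints are void, so the kernel is positive on an open set of
  configurations around a realization.\<close>

lemma W_integrand_pos:
  assumes "t > 0"
  obtains p \<delta> where "\<delta> > 0"
    "\<And>l \<rho> y. l \<in> {1..k} \<Longrightarrow> radius t \<le> c * \<rho> \<Longrightarrow> (\<And>i. i \<in> {1..l - 1} \<Longrightarrow> y i \<in> ball (p i) \<delta>) \<Longrightarrow>
      W_integrand \<Gamma> k e c l t (\<rho>, y) > 0 \<and> (\<forall>i\<in>{1..l - 1}. \<rho> + (1 / c) * (e \<bullet> y i) \<ge> 0)"
proof -
  obtain p \<delta> where \<delta>: "\<delta> > 0" and h: "\<And>l y z. l \<in> {1..k} \<Longrightarrow> (\<And>i. i \<in> {1..l - 1} \<Longrightarrow> y i \<in> ball (p i) \<delta>) \<Longrightarrow>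
      (\<And>j. j \<in> {1..k - l} \<Longrightarrow> z j \<in> ball (p (l + j - 1)) \<delta>) \<Longrightarrow>
      h_ind \<Gamma> t (map (points l y z) [0..<k]) = 1 \<and> e \<bullet> points l y z 1 \<le> - \<delta>"
    using realization[OF assms] by metis
  show ?thesis
  proof (rule that[OF \<delta>])
    fix l \<rho> y assume l: "l \<in> {1..k}" and \<rho>: "radius t \<le> c * \<rho>"
      and y: "\<And>i. i \<in> {1..l - 1} \<Longrightarrow> y i \<in> ball (p i) \<delta>"
    have pos: "kernel l t \<rho> y z > 0" and half: "\<forall>i\<in>{1..l - 1}. \<rho> + (1 / c) * (e \<bullet> y i) \<ge> 0"
      if "\<And>j. j \<in> {1..k - l} \<Longrightarrow> z j \<in> ball (p (l + j - 1)) \<delta>" for z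
    proof -
      have 1: "h_ind \<Gamma> t (map (points l y z) [0..<k]) = 1"
        using h[OF l y that] by blast
      then have "h_ind \<Gamma> t (map (points l y z) [0..<k]) \<noteq> 0" by simp
      note near = points_near[OF this less_imp_le[OF assms] l]
      show "\<forall>i\<in>{1..l - 1}. \<rho> + (1 / c) * (e \<bullet> y i) \<ge> 0"
        using in_half_space[OF near(1) \<rho>] by blast
      have "\<forall>i\<in>{1..k - l}. \<rho> + (1 / c) * (e \<bullet> z i) \<ge> 0"
        using in_half_space[OF near(2) \<rho>] by blast
      then show "kernel l t \<rho> y z > 0" using 1 by (simp add: kernel_def)
    qed
    have half': "\<forall>i\<in>{1..l - 1}. \<rho> + (1 / c) * (e \<bullet> y i) \<ge> 0"
      by (rule half[of "\<lambda>j. p (l + j - 1)"]) (use \<delta> in auto)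
    have int: "integrable (PiM {1..k - l} (\<lambda>_. lborel)) (kernel l t \<rho> y)"
      by (rule kernel_integrable) (use assms l in auto)
    have "W_integrand \<Gamma> k e c l t (\<rho>, y) \<noteq> 0"
    proof
      assume "W_integrand \<Gamma> k e c l t (\<rho>, y) = 0"
      then have "AE z in PiM {1..k - l} (\<lambda>_. lborel). kernel l t \<rho> y z = 0"
        unfolding W_integrand_eq[OF l] by (subst (asm) integral_nonneg_eq_0_iff_AE[OF int]) (auto simp: kernel_nonneg)
      then obtain z where "\<And>j. j \<in> {1..k - l} \<Longrightarrow> z j \<in> ball (p (l + j - 1)) \<delta>" "kernel l t \<rho> y z = 0"
        using AE_PiM_balls[OF _ _ \<delta>, where p = "\<lambda>j. p (l + j - 1)" and I = "{1..k - l}"] by blast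
      with pos show False by fastforce
    qed
    then show "W_integrand \<Gamma> k e c l t (\<rho>, y) > 0 \<and> (\<forall>i\<in>{1..l - 1}. \<rho> + (1 / c) * (e \<bullet> y i) \<ge> 0)"
      using W_integrand_nonneg[OF l, of t "(\<rho>, y)"] half' by simp
  qed
qed

end

section \<open>Growth of the variances\<close>

lemma D_coeff_pos: "D_coeff TYPE('d::finite) k l > 0"
  using content_ball_pos[of 1 "0 :: real ^ 'd"] by (simp add: D_coeff_def sphere_area_def)

lemma nn_integral_exp_nonneg:
  "(\<integral>\<^sup>+\<rho>. ennreal (exp (- \<rho>)) \<partial>restrict_space lborel {0 :: real..}) = 1"
proof -
  have "(\<integral>\<^sup>+\<rho>. ennreal (exp (- \<rho>)) \<partial>restrict_space lborel {0 :: real..}) =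
      (\<integral>\<^sup>+\<rho>. ennreal (exp (- \<rho>)) * indicator {0..} \<rho> \<partial>lborel)"
    by (simp add: nn_integral_restrict_space)
  also have "\<dots> = (\<integral>\<^sup>+s. ennreal (exp (- (0 + (1 / 1) * s)) * of_bool (0 + (1 / 1) * s \<ge> (0 :: real))) \<partial>lborel)"
    by (intro nn_integral_cong) (auto simp: indicator_def)
  also have "\<dots> = 1" using nn_integral_exp_half_line[of 1 0] by simp
  finally show ?thesis .
qed

text \<open>Let $t \to \infty$ if the exponent is negative and $t \to 0$ if it is positive.\<close>

lemma power_bounded_imp_exponent_zero:
  fixes a C \<beta> :: real
  assumes "a > 0" and le: "\<And>t. t > 0 \<Longrightarrow> a \<le> C * t powr \<beta>"
  shows "\<beta> = 0"
proof (rule ccontr)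
  assume "\<beta> \<noteq> 0"
  have lim: "((\<lambda>s. C * s powr - \<bar>\<beta>\<bar>) \<longlongrightarrow> C * 0) at_top"
    using \<open>\<beta> \<noteq> 0\<close> by (intro tendsto_mult tendsto_const tendsto_neg_powr filterlim_ident) auto
  have "a \<le> C * s powr - \<bar>\<beta>\<bar>" if "s > 0" for s
  proof (cases "\<beta> < 0")
    case True
    then show ?thesis using le[OF that] by simp
  next
    case False
    have "(1 / s) powr \<beta> = s powr - \<beta>"
      using that by (simp add: powr_divide powr_minus divide_simps)
    then show ?thesis using le[of "1 / s"] that False by simp
  qed
  then have "a \<le> C * 0"
    by (intro tendsto_lowerbound[OF lim]) (auto intro: eventually_at_top_linorderI[of 1])
  with \<open>a > 0\<close> show False by simp
qed

context config
begin

abbreviation base :: "nat \<Rightarrow> (real \<times> (nat \<Rightarrow> real ^ 'd)) measure" where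
  "base l \<equiv> restrict_space lborel {0..} \<Otimes>\<^sub>M PiM {1..l - 1} (\<lambda>_. lborel)"

abbreviation mu_density :: "nat \<Rightarrow> real \<Rightarrow> (nat \<Rightarrow> real ^ 'd) \<Rightarrow> real" where
  "mu_density l \<rho> y \<equiv> D_coeff TYPE('d) k l * exp (- real l * \<rho> - (1 / c) * (\<Sum>i = 1..l - 1. e \<bullet> y i)) *
     of_bool (\<forall>i\<in>{1..l - 1}. \<rho> + (1 / c) * (e \<bullet> y i) \<ge> 0)"

lemma
  shows fst_base: "fst \<in> borel_measurable (base l)"
    and snd_base: "i \<in> {1..l - 1} \<Longrightarrow> (\<lambda>x. snd x i) \<in> borel_measurable (base l)"
proof -
  have "(\<lambda>\<rho>. \<rho>) \<in> borel_measurable (restrict_space lborel {0 :: real..})"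
    by (rule measurable_restrict_space1) simp
  from measurable_compose[OF measurable_fst this] show "fst \<in> borel_measurable (base l)" by simp
  assume "i \<in> {1..l - 1}"
  then have "(\<lambda>y. y i) \<in> borel_measurable (PiM {1..l - 1} (\<lambda>_. lborel :: (real ^ 'd) measure))"
    using measurable_component_singleton[of i "{1..l - 1}" "\<lambda>_. lborel :: (real ^ 'd) measure"] by simp
  from measurable_compose[OF measurable_snd this] show "(\<lambda>x. snd x i) \<in> borel_measurable (base l)" .
qed

lemma mu_density_measurable: "(\<lambda>x. ennreal (mu_density l (fst x) (snd x))) \<in> borel_measurable (base l)"
proof -
  note [measurable] = fst_base snd_base
  show ?thesis by measurable
qed

lemma mu_eq: "mu k e c l = density (base l) (\<lambda>x. ennreal (mu_density l (fst x) (snd x)))"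
  by (simp add: mu_def case_prod_beta')

text \<open>Of the factor $e^{-\ell\rho}$, one $e^{-\rho}$ goes with each of the $\ell - 1$ points, which turns
  their exponents into $\rho + \langle e, y_i\rangle / c$; the remaining one is integrable over
  $[0, \infty)$.\<close>

lemma mu_density_factor:
  assumes "l \<in> {1..k}"
  shows "mu_density l \<rho> y = D_coeff TYPE('d) k l * exp (- \<rho>) *
    (\<Prod>i\<in>{1..l - 1}. exp (- (\<rho> + (1 / c) * (e \<bullet> y i))) * of_bool (\<rho> + (1 / c) * (e \<bullet> y i) \<ge> 0))"
proof -
  have "(\<Prod>i\<in>{1..l - 1}. exp (- (\<rho> + (1 / c) * (e \<bullet> y i))) * of_bool (\<rho> + (1 / c) * (e \<bullet> y i) \<ge> 0)) =
      (\<Prod>i\<in>{1..l - 1}. exp (- (\<rho> + (1 / c) * (e \<bullet> y i)))) *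
      (\<Prod>i\<in>{1..l - 1}. of_bool (\<rho> + (1 / c) * (e \<bullet> y i) \<ge> 0))"
    by (rule prod.distrib)
  also have "(\<Prod>i\<in>{1..l - 1}. exp (- (\<rho> + (1 / c) * (e \<bullet> y i)))) =
      exp (\<Sum>i\<in>{1..l - 1}. - (\<rho> + (1 / c) * (e \<bullet> y i)))"
    by (simp add: exp_sum)
  also have "(\<Sum>i\<in>{1..l - 1}. - (\<rho> + (1 / c) * (e \<bullet> y i))) =
      - real (l - 1) * \<rho> - (1 / c) * (\<Sum>i = 1..l - 1. e \<bullet> y i)"
    by (simp only: sum_negf sum.distrib sum_distrib_left[symmetric]) simp
  also have "- real (l - 1) * \<rho> - (1 / c) * (\<Sum>i = 1..l - 1. e \<bullet> y i) =
      \<rho> + (- real l * \<rho> - (1 / c) * (\<Sum>i = 1..l - 1. e \<bullet> y i))"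
    using assms by (simp add: of_nat_diff algebra_simps)
  also have "(\<Prod>i\<in>{1..l - 1}. of_bool (\<rho> + (1 / c) * (e \<bullet> y i) \<ge> 0)) =
      (of_bool (\<forall>i\<in>{1..l - 1}. \<rho> + (1 / c) * (e \<bullet> y i) \<ge> 0) :: real)"
  proof (cases "\<forall>i\<in>{1..l - 1}. \<rho> + (1 / c) * (e \<bullet> y i) \<ge> 0")
    case True
    then show ?thesis by (intro trans[OF prod.neutral]) auto
  next
    case False
    then show ?thesis by (intro trans[OF prod_zero]) auto
  qed
  finally show ?thesis
    by (simp add: exp_add exp_minus)
qed

text \<open>The squared integrand contributes two copies of the $k - \ell$ integrated points and the
  measure contributes the $\ell - 1$ points \<open>y\<close>, which gives the exponent
  $2(k - \ell) + (\ell - 1)$. All single-point bounds are uniform in $\rho$.\<close>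

lemma variance_le:
  assumes "t \<ge> 0" and l: "l \<in> {1..k}"
    and W: "W_integrand \<Gamma> k e c l t \<in> borel_measurable (mu k e c l)"
  shows "(\<integral>\<^sup>+x. ennreal ((W_integrand \<Gamma> k e c l t x)\<^sup>2) \<partial>mu k e c l) \<le>
    ennreal (D_coeff TYPE('d) k l * tilt_bound TYPE(real ^ 'd) c (radius t) ^ (2 * k - l - 1))"
proof -
  let ?A = "ennreal (tilt_bound TYPE(real ^ 'd) c (radius t))"
  let ?D = "ennreal (D_coeff TYPE('d) k l)"
  let ?T = "\<lambda>\<rho> y. \<Prod>i\<in>{1..l - 1}. tilt c e (radius t) \<rho> (y i)"
  let ?P = "PiM {1..l - 1} (\<lambda>_. lborel) :: (nat \<Rightarrow> real ^ 'd) measure"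
  interpret P: sigma_finite_measure ?P
    by (rule lborel_product.sigma_finite) simp
  note [measurable] = fst_base snd_base mu_density_measurable
  have [measurable]: "W_integrand \<Gamma> k e c l t \<in> borel_measurable (base l)"
    using W by (simp add: mu_eq)
  have ptw: "ennreal (mu_density l \<rho> y) * ennreal ((W_integrand \<Gamma> k e c l t (\<rho>, y))\<^sup>2) \<le>
      ?D * ?A ^ (2 * (k - l)) * (ennreal (exp (- \<rho>)) * ?T \<rho> y)" for \<rho> y
  proof -
    let ?B = "\<Prod>i\<in>{1..l - 1}. indicator {x. \<forall>b\<in>Basis. \<bar>x \<bullet> b\<bar> \<le> radius t} (y i) :: ennreal"
    have B: "?B * ?B = ?B"
      unfolding prod.distrib[symmetric] by (rule prod.cong) (auto simp: indicator_def)
    have dens: "ennreal (mu_density l \<rho> y) = ?D * ennreal (exp (- \<rho>)) *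
        (\<Prod>i\<in>{1..l - 1}. ennreal (exp (- (\<rho> + (1 / c) * (e \<bullet> y i))) * of_bool (\<rho> + (1 / c) * (e \<bullet> y i) \<ge> 0)))"
      unfolding mu_density_factor[OF l]
      by (subst prod_ennreal) (auto simp: ennreal_mult prod_nonneg less_imp_le[OF D_coeff_pos])
    have "ennreal ((W_integrand \<Gamma> k e c l t (\<rho>, y))\<^sup>2) = (ennreal (W_integrand \<Gamma> k e c l t (\<rho>, y)))\<^sup>2"
      using W_integrand_nonneg[OF l] by (simp add: ennreal_power)
    also have "\<dots> \<le> (?A ^ (k - l) * ?B)\<^sup>2"
      by (intro power_mono W_integrand_le assms) auto
    also have "\<dots> = ?A ^ (2 * (k - l)) * ?B"
    proof -
      have "(?A ^ (k - l) * ?B)\<^sup>2 = (?A ^ (k - l) * ?A ^ (k - l)) * (?B * ?B)"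
        by (simp only: power2_eq_square mult_ac)
      then show ?thesis by (simp only: B power_add[symmetric] mult_2)
    qed
    finally have "ennreal (mu_density l \<rho> y) * ennreal ((W_integrand \<Gamma> k e c l t (\<rho>, y))\<^sup>2) \<le>
        ennreal (mu_density l \<rho> y) * (?A ^ (2 * (k - l)) * ?B)"
      by (rule mult_left_mono) simp
    also have "\<dots> = ?D * ?A ^ (2 * (k - l)) * (ennreal (exp (- \<rho>)) * ?T \<rho> y)"
      unfolding dens tilt_def prod.distrib by (simp only: mult_ac)
    finally show ?thesis .
  qed
  have "(\<integral>\<^sup>+x. ennreal ((W_integrand \<Gamma> k e c l t x)\<^sup>2) \<partial>mu k e c l) =
      (\<integral>\<^sup>+x. ennreal (mu_density l (fst x) (snd x)) * ennreal ((W_integrand \<Gamma> k e c l t x)\<^sup>2) \<partial>base l)"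
    unfolding mu_eq by (rule nn_integral_density) measurable
  also have "\<dots> \<le> (\<integral>\<^sup>+x. ?D * ?A ^ (2 * (k - l)) * (ennreal (exp (- fst x)) * ?T (fst x) (snd x)) \<partial>base l)"
  proof (intro nn_integral_mono)
    fix x
    show "ennreal (mu_density l (fst x) (snd x)) * ennreal ((W_integrand \<Gamma> k e c l t x)\<^sup>2) \<le>
        ?D * ?A ^ (2 * (k - l)) * (ennreal (exp (- fst x)) * ?T (fst x) (snd x))"
      using ptw[of "fst x" "snd x"] unfolding prod.collapse .
  qed
  also have "\<dots> = ?D * ?A ^ (2 * (k - l)) * (\<integral>\<^sup>+x. ennreal (exp (- fst x)) * ?T (fst x) (snd x) \<partial>base l)"
    by (rule nn_integral_cmult) measurable
  also have "(\<integral>\<^sup>+x. ennreal (exp (- fst x)) * ?T (fst x) (snd x) \<partial>base l) =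
      (\<integral>\<^sup>+\<rho>. \<integral>\<^sup>+y. ennreal (exp (- \<rho>)) * ?T \<rho> y \<partial>?P \<partial>restrict_space lborel {0..})"
  proof -
    have "(\<lambda>x. ennreal (exp (- fst x)) * ?T (fst x) (snd x)) \<in> borel_measurable (base l)"
      by measurable
    from P.nn_integral_fst[OF this] show ?thesis by simp
  qed
  also have "\<dots> \<le> (\<integral>\<^sup>+\<rho>. ennreal (exp (- \<rho>)) * ?A ^ (l - 1) \<partial>restrict_space lborel {0..})"
  proof (intro nn_integral_mono)
    fix \<rho> :: real
    have [measurable]: "(\<lambda>y. y i) \<in> borel_measurable ?P" if "i \<in> {1..l - 1}" for i
      using measurable_component_singleton[OF that, of "\<lambda>_. lborel :: (real ^ 'd) measure"] by simp
    have "(\<integral>\<^sup>+y. ennreal (exp (- \<rho>)) * ?T \<rho> y \<partial>?P) = ennreal (exp (- \<rho>)) * (\<integral>\<^sup>+y. ?T \<rho> y \<partial>?P)"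
      by (rule nn_integral_cmult) measurable
    also have "\<dots> \<le> ennreal (exp (- \<rho>)) * ?A ^ card {1..l - 1}"
      by (intro mult_left_mono nn_integral_prod_tilt_le e c) (use assms in auto)
    finally show "(\<integral>\<^sup>+y. ennreal (exp (- \<rho>)) * ?T \<rho> y \<partial>?P) \<le> ennreal (exp (- \<rho>)) * ?A ^ (l - 1)" by simp
  qed
  also have "\<dots> = (\<integral>\<^sup>+\<rho>. ennreal (exp (- \<rho>)) \<partial>restrict_space lborel {0 :: real..}) * ?A ^ (l - 1)"
    by (rule nn_integral_multc) (auto intro: measurable_restrict_space1)
  also have "\<dots> = ?A ^ (l - 1)" by (simp add: nn_integral_exp_nonneg)
  finally have "(\<integral>\<^sup>+x. ennreal ((W_integrand \<Gamma> k e c l t x)\<^sup>2) \<partial>mu k e c l) \<le>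
      ?D * ?A ^ (2 * (k - l)) * ?A ^ (l - 1)"
    by (simp add: mult_left_mono)
  also have "\<dots> = ?D * ?A ^ (2 * k - l - 1)"
  proof -
    have "2 * (k - l) + (l - 1) = 2 * k - l - 1" using l by auto
    then show ?thesis by (simp only: mult.assoc power_add[symmetric])
  qed
  also have "\<dots> = ennreal (D_coeff TYPE('d) k l * tilt_bound TYPE(real ^ 'd) c (radius t) ^ (2 * k - l - 1))"
  proof -
    have A: "0 \<le> tilt_bound TYPE(real ^ 'd) c (radius t)"
      using assms(1) c by (simp add: tilt_bound_def)
    show ?thesis
      unfolding ennreal_power[OF A]
      by (rule ennreal_mult[symmetric]) (use A in \<open>auto simp: less_imp_le[OF D_coeff_pos]\<close>)
  qed
  finally show ?thesis .
qed

text \<open>The density of $\mu_\ell$ is positive where the constraints on \<open>y\<close> hold, so a property that holds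
  $\mu_\ell$-almost everywhere can be tested at some point of such a box.\<close>

lemma AE_mu_box:
  fixes p :: "nat \<Rightarrow> real ^ 'd"
  assumes P: "AE x in mu k e c l. P x" and "0 \<le> a" "a < b" "\<delta> > 0"
    and half: "\<And>\<rho> y i. \<rho> \<in> {a..b} \<Longrightarrow> (\<And>i. i \<in> {1..l - 1} \<Longrightarrow> y i \<in> ball (p i) \<delta>) \<Longrightarrow>
      \<forall>i\<in>{1..l - 1}. \<rho> + (1 / c) * (e \<bullet> y i) \<ge> 0"
  obtains \<rho> y where "\<rho> \<in> {a..b}" "\<And>i. i \<in> {1..l - 1} \<Longrightarrow> y i \<in> ball (p i) \<delta>" "P (\<rho>, y)"
proof -
  let ?R = "restrict_space lborel {0 :: real..}"
  let ?P = "PiM {1..l - 1} (\<lambda>_. lborel) :: (nat \<Rightarrow> real ^ 'd) measure"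
  let ?S = "Pi\<^sub>E {1..l - 1} (\<lambda>i. ball (p i) \<delta>)"
  interpret P: sigma_finite_measure ?P
    by (rule lborel_product.sigma_finite) simp
  have ab: "{a..b} \<in> sets ?R"
    using \<open>0 \<le> a\<close> by (auto simp: sets_restrict_space intro!: image_eqI[of _ _ "{a..b}"])
  have S: "?S \<in> sets ?P"
    by (rule sets_PiM_I_finite) auto
  have prod: "{a..b} \<times> ?S \<in> sets (base l)"
    using ab S by simp
  have "emeasure ?R {a..b} \<noteq> 0"
    using \<open>0 \<le> a\<close> \<open>a < b\<close> by (subst emeasure_restrict_space) auto
  moreover have "emeasure ?P ?S = (\<Prod>i\<in>{1..l - 1}. emeasure lborel (ball (p i) \<delta>))"
    by (rule lborel_product.emeasure_PiM) auto
  then have "emeasure ?P ?S \<noteq> 0"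
    using \<open>\<delta> > 0\<close> by (simp add: emeasure_ball_neq_0)
  ultimately have pos: "emeasure (base l) ({a..b} \<times> ?S) \<noteq> 0"
    by (subst P.emeasure_pair_measure_Times[OF ab S]) simp
  have AE: "AE x in base l. 0 < ennreal (mu_density l (fst x) (snd x)) \<longrightarrow> P x"
    using P unfolding mu_eq AE_density[OF mu_density_measurable] .
  have "emeasure (base l) ({a..b} \<times> ?S) = 0" if none: "\<forall>x\<in>{a..b} \<times> ?S. \<not> P x"
  proof -
    have "0 < ennreal (mu_density l (fst x) (snd x))" if "x \<in> {a..b} \<times> ?S" for x
      using half[of "fst x" "snd x"] that D_coeff_pos[where 'd = 'd, of k l] by (auto simp: PiE_iff)
    with AE have "AE x in base l. x \<notin> {a..b} \<times> ?S"
      using none by (auto elim!: eventually_mono)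
    then show ?thesis
      using prod by (simp only: AE_iff_null_sets[symmetric] null_setsD1)
  qed
  with pos obtain x where "x \<in> {a..b} \<times> ?S" "P x" by blast
  then show ?thesis
    using that[of "fst x" "snd x"] by (auto simp: PiE_iff)
qed

lemma W_integrand_not_AE_zero:
  assumes "t > 0" "l \<in> {1..k}"
  shows "\<not> (AE x in mu k e c l. W_integrand \<Gamma> k e c l t x = 0)"
proof
  assume AE: "AE x in mu k e c l. W_integrand \<Gamma> k e c l t x = 0"
  obtain p \<delta> where \<delta>: "\<delta> > 0" and W: "\<And>\<rho> y. radius t \<le> c * \<rho> \<Longrightarrow> (\<And>i. i \<in> {1..l - 1} \<Longrightarrow> y i \<in> ball (p i) \<delta>) \<Longrightarrow>
      W_integrand \<Gamma> k e c l t (\<rho>, y) > 0 \<and> (\<forall>i\<in>{1..l - 1}. \<rho> + (1 / c) * (e \<bullet> y i) \<ge> 0)"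
    using W_integrand_pos[OF assms(1)] assms(2) by metis
  define a where "a = radius t / c"
  have a: "0 \<le> a" "radius t = c * a" using assms(1) c by (auto simp: a_def)
  have ge: "radius t \<le> c * \<rho>" if "\<rho> \<in> {a..a + 1}" for \<rho>
    using that c unfolding a(2) by (intro mult_left_mono) auto
  obtain \<rho> y where "\<rho> \<in> {a..a + 1}" "\<And>i. i \<in> {1..l - 1} \<Longrightarrow> y i \<in> ball (p i) \<delta>"
    "W_integrand \<Gamma> k e c l t (\<rho>, y) = 0"
    by (rule AE_mu_box[OF AE \<open>0 \<le> a\<close> _ \<delta>, of "a + 1" p]) (use W ge in \<open>simp, blast+\<close>)
  with W[OF ge] show False by fastforce
qed

text \<open>Both bounds on $V(t)$, of order $t^{dN}$ and $t^{(d-1)N}$, come from the two terms of the minimum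
  in \<open>tilt_bound\<close>.\<close>

lemma not_self_similar:
  assumes M: "prob_space M" and H: "gaussian_noise M (mu k e c l) H" and l: "l \<in> {1..k}"
    and W: "\<And>t. t \<ge> 0 \<Longrightarrow> is_noise_integral M (mu k e c l) H (W_integrand \<Gamma> k e c l t) (X t)"
  shows "\<not> self_similar M X \<eta>"
proof
  assume ss: "self_similar M X \<eta>"
  interpret noise M "mu k e c l" H
    using M H by (simp add: noise_def noise_axioms_def)
  define V where "V t = (\<integral>x. (W_integrand \<Gamma> k e c l t x)\<^sup>2 \<partial>mu k e c l)" for t
  note law = noise_integral_law[OF W]
  have V1: "V 1 > 0"
  proof -
    have "V 1 \<noteq> 0"
      using W_integrand_not_AE_zero[OF _ l, of 1] law(1)[of 1] unfolding V_def
      by (subst integral_nonneg_eq_0_iff_AE) auto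
    then show ?thesis by (simp add: V_def order_less_le)
  qed
  define N where "N = 2 * k - l - 1"
  have N: "N \<ge> 1" using l k by (auto simp: N_def)
  define B where "B t = tilt_bound TYPE(real ^ 'd) c (radius t)" for t
  have VB: "t powr (2 * \<eta>) * V 1 \<le> D_coeff TYPE('d) k l * B t ^ N" if "t > 0" for t
  proof -
    have "ennreal (V t) = (\<integral>\<^sup>+x. ennreal ((W_integrand \<Gamma> k e c l t x)\<^sup>2) \<partial>mu k e c l)"
      unfolding V_def using law(1)[of t] that by (intro nn_integral_eq_integral[symmetric]) auto
    also have "\<dots> \<le> ennreal (D_coeff TYPE('d) k l * B t ^ N)"
      unfolding B_def N_def
      by (rule variance_le) (use W[of t] that l in \<open>auto simp: is_noise_integral_def\<close>)
    finally have "V t \<le> D_coeff TYPE('d) k l * B t ^ N"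
      by (subst (asm) ennreal_le_iff)
        (use c that D_coeff_pos[where 'd = 'd, of k l] in \<open>auto simp: B_def tilt_bound_def intro!: mult_nonneg_nonneg\<close>)
    then show ?thesis
      using self_similar_variance[OF W ss, of t 1] that by (simp add: V_def)
  qed
  have exponent: "real n = 2 * \<eta>"
    if B_le: "\<And>t. t > 0 \<Longrightarrow> B t ^ N \<le> C * t ^ n" and C: "C \<ge> 0" for n C
  proof -
    have "real n - 2 * \<eta> = 0"
    proof (rule power_bounded_imp_exponent_zero[OF V1])
      fix t :: real assume t: "t > 0"
      have "t powr (2 * \<eta>) * V 1 \<le> D_coeff TYPE('d) k l * (C * t ^ n)"
        using VB[OF t] B_le[OF t] D_coeff_pos[where 'd = 'd, of k l]
        by (meson less_imp_le mult_left_mono order_trans)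
      then have "t powr - (2 * \<eta>) * (t powr (2 * \<eta>) * V 1) \<le> t powr - (2 * \<eta>) * (D_coeff TYPE('d) k l * (C * t powr n))"
        using t by (intro mult_left_mono) (auto simp: powr_realpow)
      then show "V 1 \<le> (D_coeff TYPE('d) k l * C) * t powr (real n - 2 * \<eta>)"
        using t by (simp add: powr_diff powr_minus field_simps)
    qed
    then show ?thesis by simp
  qed
  define d where "d = DIM(real ^ 'd)"
  have d: "d \<ge> 1" using DIM_positive[where 'a = "real ^ 'd"] unfolding d_def by linarith
  define q where "q = 2 * real (k * k)"
  have B_eq: "B t = min (q * t) c * (q * t) ^ (d - 1)" for t
    by (simp add: B_def tilt_bound_def q_def d_def mult_ac)
  have q: "q > 0" using k by (simp add: q_def)
  have "B t ^ N \<le> (q ^ d) ^ N * t ^ (d * N)" if "t > 0" for t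
  proof -
    have "B t \<le> (q * t) * (q * t) ^ (d - 1)"
      unfolding B_eq using q that by (intro mult_right_mono) auto
    also have "\<dots> = (q * t) ^ d" using d by (simp add: power_eq_if)
    finally have "B t ^ N \<le> ((q * t) ^ d) ^ N"
      using q that c by (intro power_mono) (auto simp: B_eq)
    then show ?thesis by (simp add: power_mult_distrib power_mult)
  qed
  then have 1: "real (d * N) = 2 * \<eta>" by (rule exponent) (use q in auto)
  have "B t ^ N \<le> (c * q ^ (d - 1)) ^ N * t ^ ((d - 1) * N)" if "t > 0" for t
  proof -
    have "B t \<le> c * (q * t) ^ (d - 1)"
      unfolding B_eq using q that by (intro mult_right_mono) auto
    then have "B t ^ N \<le> (c * (q * t) ^ (d - 1)) ^ N"
      using q that c by (intro power_mono) (auto simp: B_eq)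
    then show ?thesis by (simp add: power_mult_distrib power_mult mult.assoc)
  qed
  then have 2: "real ((d - 1) * N) = 2 * \<eta>" by (rule exponent) (use q c in auto)
  from 1 2 have "d * N = (d - 1) * N" by linarith
  then show False using N d by simp
qed

section \<open>Non-degeneracy of the process with one shared point\<close>

text \<open>After multiplication by $e^{(k-1)\rho}$, the dependence on $\rho$ is confined to the half-space
  constraints. For $\ell = 1$ there are no points \<open>y\<close>, and \<open>undefined\<close> stands for the empty family.\<close>

lemma scaled_kernel_1:
  "exp (real (k - 1) * \<rho>) * kernel 1 t \<rho> y z = exp (- (1 / c) * (\<Sum>i = 1..k - 1. e \<bullet> z i)) *
     of_bool (\<forall>i\<in>{1..k - 1}. \<rho> + (1 / c) * (e \<bullet> z i) \<ge> 0) * h_ind \<Gamma> t (map (points 1 undefined z) [0..<k])"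
proof -
  have "points 1 y z = points 1 undefined z"
    by (auto simp: points_def)
  moreover have "(\<Sum>i = 1..k - 1. \<rho> + (1 / c) * (e \<bullet> z i)) =
      real (k - 1) * \<rho> + (1 / c) * (\<Sum>i = 1..k - 1. e \<bullet> z i)"
    by (simp only: sum.distrib sum_distrib_left[symmetric]) simp
  moreover have "exp (real (k - 1) * \<rho>) * exp (- (real (k - 1) * \<rho> + (1 / c) * (\<Sum>i = 1..k - 1. e \<bullet> z i))) =
      exp (- (1 / c) * (\<Sum>i = 1..k - 1. e \<bullet> z i))"
    by (simp flip: exp_add)
  ultimately show ?thesis
    unfolding kernel_def by (simp only: mult.assoc[symmetric])
qed

text \<open>The integrand of $W_1(t)$ freed from its exponential decay, so that it is non-decreasing in $\rho$
  and eventually constant.\<close>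

definition profile :: "real \<Rightarrow> real \<Rightarrow> real" where
  "profile t \<rho> = (\<integral>z. exp (real (k - 1) * \<rho>) * kernel 1 t \<rho> undefined z \<partial>PiM {1..k - 1} (\<lambda>_. lborel))"

lemma one_mem: "1 \<in> {1..k}" using k by simp

lemma W_integrand_1: "W_integrand \<Gamma> k e c 1 t (\<rho>, y) = exp (- real (k - 1) * \<rho>) * profile t \<rho>"
proof -
  have "W_integrand \<Gamma> k e c 1 t (\<rho>, y) =
      (\<integral>z. exp (- real (k - 1) * \<rho>) * (exp (real (k - 1) * \<rho>) * kernel 1 t \<rho> y z) \<partial>PiM {1..k - 1} (\<lambda>_. lborel))"
    unfolding W_integrand_eq[OF one_mem] by (simp add: exp_minus)
  then show ?thesis
    by (simp add: scaled_kernel_1 profile_def del: One_nat_def)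
qed

lemma profile_eventually_const:
  assumes "t \<ge> 0" "radius t \<le> c * \<rho>" "radius t \<le> c * \<rho>'"
  shows "profile t \<rho> = profile t \<rho>'"
  unfolding profile_def scaled_kernel_1
proof (rule Bochner_Integration.integral_cong[OF refl])
  fix z
  have "(\<forall>i\<in>{1..k - 1}. \<rho> + (1 / c) * (e \<bullet> z i) \<ge> 0) \<and> (\<forall>i\<in>{1..k - 1}. \<rho>' + (1 / c) * (e \<bullet> z i) \<ge> 0)"
    if "h_ind \<Gamma> t (map (points 1 undefined z) [0..<k]) \<noteq> 0"
    using in_half_space[OF points_near(2)[OF that assms(1) one_mem] assms(2)]
      in_half_space[OF points_near(2)[OF that assms(1) one_mem] assms(3)] by blast
  then show "exp (- (1 / c) * (\<Sum>i = 1..k - 1. e \<bullet> z i)) *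
     of_bool (\<forall>i\<in>{1..k - 1}. \<rho> + (1 / c) * (e \<bullet> z i) \<ge> 0) * h_ind \<Gamma> t (map (points 1 undefined z) [0..<k]) =
     exp (- (1 / c) * (\<Sum>i = 1..k - 1. e \<bullet> z i)) *
     of_bool (\<forall>i\<in>{1..k - 1}. \<rho>' + (1 / c) * (e \<bullet> z i) \<ge> 0) * h_ind \<Gamma> t (map (points 1 undefined z) [0..<k])"
    by (cases "h_ind \<Gamma> t (map (points 1 undefined z) [0..<k]) = 0") simp_all
qed

text \<open>For $\rho < \delta / c$ the constraints exclude the realizations whose point with index 1 satisfies
  $\langle e, x_1\rangle \le -\delta$, and these have positive measure.\<close>

lemma profile_strict:
  assumes "t > 0"
  obtains \<epsilon> where "\<epsilon> > 0" "\<And>\<rho> \<rho>'. \<rho> < \<epsilon> \<Longrightarrow> radius t \<le> c * \<rho>' \<Longrightarrow> profile t \<rho> < profile t \<rho>'"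
proof -
  obtain p \<delta> where \<delta>: "\<delta> > 0" and h: "\<And>l y z. l \<in> {1..k} \<Longrightarrow> (\<And>i. i \<in> {1..l - 1} \<Longrightarrow> y i \<in> ball (p i) \<delta>) \<Longrightarrow>
      (\<And>j. j \<in> {1..k - l} \<Longrightarrow> z j \<in> ball (p (l + j - 1)) \<delta>) \<Longrightarrow>
      h_ind \<Gamma> t (map (points l y z) [0..<k]) = 1 \<and> e \<bullet> points l y z 1 \<le> - \<delta>"
    using realization[OF assms] by metis
  show ?thesis
  proof (rule that[of "\<delta> / c"])
    show "\<delta> / c > 0" using \<delta> c by simp
    fix \<rho> \<rho>' assume \<rho>: "\<rho> < \<delta> / c" and \<rho>': "radius t \<le> c * \<rho>'"
    let ?M = "PiM {1..k - 1} (\<lambda>_. lborel) :: (nat \<Rightarrow> real ^ 'd) measure"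
    define G where "G r z = exp (real (k - 1) * r) * kernel 1 t r undefined z" for r z
    have int: "integrable ?M (G r)" for r
      unfolding G_def using kernel_integrable[OF less_imp_le[OF assms] one_mem] by simp
    have prof: "profile t r = (\<integral>z. G r z \<partial>?M)" for r
      by (simp add: profile_def G_def)
    have le: "G \<rho> z \<le> G \<rho>' z" for z
    proof (cases "h_ind \<Gamma> t (map (points 1 undefined z) [0..<k]) = 0")
      case False
      have "\<forall>i\<in>{1..k - 1}. \<rho>' + (1 / c) * (e \<bullet> z i) \<ge> 0"
        using in_half_space[OF points_near(2)[OF False less_imp_le[OF assms] one_mem] \<rho>'] by blast
      then show ?thesis
        unfolding G_def scaled_kernel_1 by (intro mult_right_mono mult_left_mono) (auto simp: h_ind_range)
    qed (simp add: G_def scaled_kernel_1 del: One_nat_def)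
    have neq: "G \<rho> z \<noteq> G \<rho>' z" if z: "\<And>j. j \<in> {1..k - 1} \<Longrightarrow> z j \<in> ball (p j) \<delta>" for z
    proof -
      have h1: "h_ind \<Gamma> t (map (points 1 undefined z) [0..<k]) = 1" and low: "e \<bullet> points 1 undefined z 1 \<le> - \<delta>"
        using h[OF one_mem, of undefined z] z by auto
      then have h0: "h_ind \<Gamma> t (map (points 1 undefined z) [0..<k]) \<noteq> 0" by simp
      have "\<forall>i\<in>{1..k - 1}. \<rho>' + (1 / c) * (e \<bullet> z i) \<ge> 0"
        using in_half_space[OF points_near(2)[OF h0 less_imp_le[OF assms] one_mem] \<rho>'] by blast
      then have "G \<rho>' z = exp (- (1 / c) * (\<Sum>i = 1..k - 1. e \<bullet> z i))"
        unfolding G_def scaled_kernel_1 h1 by simp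
      moreover have "\<not> (\<forall>i\<in>{1..k - 1}. \<rho> + (1 / c) * (e \<bullet> z i) \<ge> 0)"
      proof
        assume "\<forall>i\<in>{1..k - 1}. \<rho> + (1 / c) * (e \<bullet> z i) \<ge> 0"
        then have "\<rho> + (1 / c) * (e \<bullet> z 1) \<ge> 0" using k by auto
        then have "\<rho> * c + e \<bullet> z 1 \<ge> 0" using c by (simp add: field_simps)
        moreover have "\<rho> * c < \<delta>" using \<rho> c by (simp add: pos_less_divide_eq)
        moreover have "e \<bullet> z 1 \<le> - \<delta>" using low by (simp add: points_def)
        ultimately show False by linarith
      qed
      then have "G \<rho> z = 0"
        unfolding G_def scaled_kernel_1 by simp
      ultimately show ?thesis by simp
    qed
    have "(\<integral>z. G \<rho>' z - G \<rho> z \<partial>?M) \<noteq> 0"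
    proof
      assume "(\<integral>z. G \<rho>' z - G \<rho> z \<partial>?M) = 0"
      then have "AE z in ?M. G \<rho>' z - G \<rho> z = 0"
        using int le by (subst (asm) integral_nonneg_eq_0_iff_AE) auto
      then obtain z where "\<And>j. j \<in> {1..k - 1} \<Longrightarrow> z j \<in> ball (p j) \<delta>" "G \<rho>' z - G \<rho> z = 0"
        using AE_PiM_balls[OF _ _ \<delta>, where p = p and I = "{1..k - 1}"] by blast
      with neq show False by force
    qed
    moreover have "(\<integral>z. G \<rho>' z - G \<rho> z \<partial>?M) \<ge> 0"
      by (rule integral_nonneg_AE) (use le in auto)
    ultimately show "profile t \<rho> < profile t \<rho>'"
      unfolding prof using int by simp
  qed
qed

lemma W_1_not_degenerate:
  assumes M: "prob_space M" and H: "gaussian_noise M (mu k e c 1) H"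
    and W: "\<And>t. t \<ge> 0 \<Longrightarrow> is_noise_integral M (mu k e c 1) H (W_integrand \<Gamma> k e c 1 t) (X t)"
  shows "\<not> degenerate_process M X"
proof
  interpret noise M "mu k e c 1" H
    using M H by (simp add: noise_def noise_axioms_def)
  assume "degenerate_process M X"
  then obtain g Z where gZ: "\<And>t. t \<ge> 0 \<Longrightarrow> AE \<omega> in M. X t \<omega> = g t * Z \<omega>"
    unfolding degenerate_process_def by blast
  obtain \<epsilon> where \<epsilon>: "\<epsilon> > 0" and strict: "\<And>\<rho> \<rho>'. \<rho> < \<epsilon> \<Longrightarrow> radius 1 \<le> c * \<rho>' \<Longrightarrow> profile 1 \<rho> < profile 1 \<rho>'"
    using profile_strict[of 1] by auto
  \<comment> \<open>With this choice the profile at scale $s$ is constant from $\epsilon / 2$ on, while the one at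
    scale 1 is still below its final value up to $\epsilon$.\<close>
  define s where "s = c * \<epsilon> / (2 * real (k * k))"
  have s: "s > 0" and rs: "radius s = c * (\<epsilon> / 2)"
    using c \<epsilon> k by (auto simp: s_def)
  have "is_noise_integral M (mu k e c 1) H
      (\<lambda>x. g 1 * W_integrand \<Gamma> k e c 1 s x + (- g s) * W_integrand \<Gamma> k e c 1 1 x)
      (\<lambda>\<omega>. g 1 * X s \<omega> + (- g s) * X 1 \<omega>)"
    by (rule noise_integral_lin[OF W W]) (use s in auto)
  moreover have "AE \<omega> in M. g 1 * X s \<omega> + (- g s) * X 1 \<omega> = 0"
    using gZ[OF less_imp_le[OF s]] gZ[OF zero_le_one] by eventually_elim simp
  ultimately have AE: "AE x in mu k e c 1. g 1 * W_integrand \<Gamma> k e c 1 s x + (- g s) * W_integrand \<Gamma> k e c 1 1 x = 0"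
    by (rule noise_integral_AE_zero)
  have proportional: "\<exists>\<rho>\<in>{a..b}. g 1 * profile s \<rho> = g s * profile 1 \<rho>" if ab: "0 \<le> a" "a < b" for a b
  proof -
    obtain \<rho> y where "\<rho> \<in> {a..b}"
      "g 1 * W_integrand \<Gamma> k e c 1 s (\<rho>, y) + (- g s) * W_integrand \<Gamma> k e c 1 1 (\<rho>, y) = 0"
      by (rule AE_mu_box[OF AE ab zero_less_one]) auto
    moreover from this(2) have "exp (- real (k - 1) * \<rho>) * (g 1 * profile s \<rho> - g s * profile 1 \<rho>) = 0"
      unfolding W_integrand_1 by (simp add: algebra_simps)
    ultimately show ?thesis by auto
  qed
  obtain \<rho>\<^sub>1 where \<rho>1: "\<rho>\<^sub>1 \<in> {\<epsilon> / 2..3 * \<epsilon> / 4}" "g 1 * profile s \<rho>\<^sub>1 = g s * profile 1 \<rho>\<^sub>1"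
    using proportional[of "\<epsilon> / 2" "3 * \<epsilon> / 4"] \<epsilon> by auto
  define a where "a = max \<epsilon> (radius 1 / c)"
  have "0 \<le> a" using \<epsilon> by (simp add: a_def)
  then obtain \<rho>\<^sub>2 where \<rho>2: "\<rho>\<^sub>2 \<in> {a..a + 1}" "g 1 * profile s \<rho>\<^sub>2 = g s * profile 1 \<rho>\<^sub>2"
    using proportional[of a "a + 1"] by auto
  have "radius 1 / c \<le> \<rho>\<^sub>2" using \<rho>2(1) by (simp add: a_def)
  then have big: "radius 1 \<le> c * \<rho>\<^sub>2" using c by (simp add: pos_divide_le_eq mult.commute)
  have "profile s \<rho>\<^sub>1 = profile s \<rho>\<^sub>2"
  proof (rule profile_eventually_const)
    show "radius s \<le> c * \<rho>\<^sub>1" "radius s \<le> c * \<rho>\<^sub>2"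
      unfolding rs using \<rho>1(1) \<rho>2(1) c \<epsilon> by (auto simp: a_def intro!: mult_left_mono)
  qed (use s in simp)
  then have "g s * profile 1 \<rho>\<^sub>1 = g s * profile 1 \<rho>\<^sub>2"
    using \<rho>1(2) \<rho>2(2) by metis
  moreover have "profile 1 \<rho>\<^sub>1 < profile 1 \<rho>\<^sub>2"
    by (rule strict[OF _ big]) (use \<rho>1(1) \<epsilon> in auto)
  ultimately have "g s = 0" by auto
  then have "AE \<omega> in M. X s \<omega> = 0"
    using gZ[of s] s by simp
  then have "AE x in mu k e c 1. W_integrand \<Gamma> k e c 1 s x = 0"
    using noise_integral_AE_zero[OF W] s by simp
  with W_integrand_not_AE_zero[OF s one_mem] show False by blast
qed

end

theorem proposition5p1:
  fixes \<Gamma> :: "'v graph" and k :: nat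
    and i\<^sub>1 :: "'d::finite"
    and \<psi> \<psi>' \<psi>'' :: "real \<Rightarrow> real" and c :: real
    and M :: "'w measure"
    and H :: "nat \<Rightarrow> (real \<times> (nat \<Rightarrow> real ^ 'd)) set \<Rightarrow> 'w \<Rightarrow> real"
    and W :: "nat \<Rightarrow> real \<Rightarrow> 'w \<Rightarrow> real"
  assumes k: "k \<ge> 2"
    and \<Gamma>: "simple_graph \<Gamma>" "connected_graph \<Gamma>" "card (verts \<Gamma>) = k"
    and feasible: "\<exists>(X :: (real ^ 'd) set) t. finite X \<and> t \<ge> 0 \<and> graph_iso (geometric_graph X t) \<Gamma>"
    and \<psi>': "\<And>z. z \<ge> 0 \<Longrightarrow> (\<psi> has_real_derivative \<psi>' z) (at z within {0..})"
    and \<psi>'': "\<And>z. z \<ge> 0 \<Longrightarrow> (\<psi>' has_real_derivative \<psi>'' z) (at z within {0..})"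
    and \<psi>''_cont: "continuous_on {0..} \<psi>''"
    and \<psi>'_pos: "\<And>z. z > 0 \<Longrightarrow> \<psi>' z > 0"
    and \<psi>_lim: "filterlim \<psi> at_top at_top"
    and a_deriv: "((\<lambda>z. deriv (\<lambda>x. 1 / \<psi>' x) z) \<longlongrightarrow> 0) at_top"
    and a_lim: "((\<lambda>z. 1 / \<psi>' z) \<longlongrightarrow> c) at_top"
    and c: "c > 0"
    and M: "prob_space M"
    and H_noise: "\<And>l. l \<in> {1..k} \<Longrightarrow> gaussian_noise M (mu k (axis i\<^sub>1 1) c l) (H l)"
    and H_indep: "prob_space.indep_sets M
                    (\<lambda>l. noise_events M (mu k (axis i\<^sub>1 1) c l) (H l)) {1..k}"
    and W: "\<And>l t. l \<in> {1..k} \<Longrightarrow> t \<ge> 0 \<Longrightarrow>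
              is_noise_integral M (mu k (axis i\<^sub>1 1) c l) (H l)
                (W_integrand \<Gamma> k (axis i\<^sub>1 1) c l t) (W l t)"
  shows "(centered_gaussian_process M (W 1) \<and> \<not> degenerate_process M (W 1)) \<and>
         (\<forall>l\<in>{1..k}. \<forall>\<eta>. \<not> self_similar M (W l) \<eta>)"
proof -
  interpret config \<Gamma> k "axis i\<^sub>1 1 :: real ^ 'd" c
    using k \<Gamma> feasible c by unfold_locales (auto simp: Basis_vec_def)
  have one: "1 \<in> {1..k}" using k by simp
  interpret noise M "mu k (axis i\<^sub>1 1) c 1" "H 1"
    using M H_noise[OF one] by (simp add: noise_def noise_axioms_def)
  show ?thesis
  proof (intro conjI ballI allI)
    show "centered_gaussian_process M (W 1)"
      by (rule centered_gaussian_noise_integral) (rule W[OF one])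
    show "\<not> degenerate_process M (W 1)"
      by (rule W_1_not_degenerate[OF M H_noise[OF one] W[OF one]])
    show "\<not> self_similar M (W l) \<eta>" if "l \<in> {1..k}" for l \<eta>
      by (rule not_self_similar[OF M H_noise[OF that] that W[OF that]])
  qed
qed

end
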